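(* The function $\mathfrak{e}:(0,\infty)\to\mathbb{R}$, $b\mapsto \mathfrak{e}(b)=\inf_{m\in\mathbb{Z}}\lambda_m(b)$, is non-monotonic, i.e. it is neither non-decreasing nor non-increasing on $(0,\infty)$.
   Context: Let $\mathcal{H}=L^2((0,\pi);\sin\theta\,d\theta)$ with norm $\|\cdot\|_{\mathcal{H}}$. For $m\in\mathbb{Z}$ and $b>0$ define the quadratic form $$q_{m,b}(f)=\int_0^{\pi}\Bigl(|f'(\theta)|^2+\Bigl(\frac{m}{\sin\theta}-\frac{b}{2}\Bigr)^2|f(\theta)|^2\Bigr)\sin\theta\,d\theta$$ with domain $$\mathcal{D}(q_{m,b})=\begin{cases}\{f\in\mathcal{H}:\ \tfrac{1}{\sin\theta}f\in\mathcal{H},\ f'\in\mathcal{H}\} & \text{if } m\neq 0,\\ \{f\in\mathcal{H}:\ f'\in\mathcal{H}\} & \text{if } m=0,\end{cases}$$ where $f'$ denotes the weak derivative on $(0,\pi)$. Set $$\lambda_m(b)=\inf_{f\in\mathcal{D}(q_{m,b})\setminus\{0\}}\frac{q_{m,b}(f)}{\|f\|_{\mathcal{H}}^2}.$$ *)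

theory Defs
  imports "HOL-Analysis.Analysis"
begin

definition sphere_measure :: "real measure" where
  "sphere_measure = density (lebesgue_on {0<..<pi}) (\<lambda>\<theta>. ennreal (sin \<theta>))"

text \<open>Elements of the Hilbert space are represented by functions (only their values on the open
  interval matter); equality in the Hilbert space is equality almost everywhere.\<close>

definition H_space :: "(real \<Rightarrow> complex) set" where
  "H_space = {f \<in> borel_measurable sphere_measure.
                integrable sphere_measure (\<lambda>\<theta>. (norm (f \<theta>))\<^sup>2)}"

definition H_norm :: "(real \<Rightarrow> complex) \<Rightarrow> real" where
  "H_norm f = sqrt (LINT \<theta>|sphere_measure. (norm (f \<theta>))\<^sup>2)"

text \<open>If all iterates are differentiable everywhere, then \<^const>\<open>deriv\<close> is the genuine derivative
  at every stage, so this is smoothness. The closure of the support is bounded, hence compact.\<close>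

definition test_function :: "(real \<Rightarrow> real) \<Rightarrow> bool" where
  "test_function \<phi> \<longleftrightarrow>
     (\<forall>k x. ((deriv ^^ k) \<phi>) differentiable (at x)) \<and>
     closure {x. \<phi> x \<noteq> 0} \<subseteq> {0<..<pi}"

definition locally_integrable :: "(real \<Rightarrow> complex) \<Rightarrow> bool" where
  "locally_integrable f \<longleftrightarrow>
     (\<forall>a b. 0 < a \<longrightarrow> a \<le> b \<longrightarrow> b < pi \<longrightarrow> set_integrable lebesgue {a..b} f)"

definition has_weak_deriv :: "(real \<Rightarrow> complex) \<Rightarrow> (real \<Rightarrow> complex) \<Rightarrow> bool" where
  "has_weak_deriv f g \<longleftrightarrow>
     locally_integrable f \<and> locally_integrable g \<and>
     (\<forall>\<phi>. test_function \<phi> \<longrightarrow>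
        (LINT \<theta>|lebesgue_on {0<..<pi}. deriv \<phi> \<theta> *\<^sub>R f \<theta>) =
        - (LINT \<theta>|lebesgue_on {0<..<pi}. \<phi> \<theta> *\<^sub>R g \<theta>))"

definition weakly_differentiable :: "(real \<Rightarrow> complex) \<Rightarrow> bool" where
  "weakly_differentiable f \<longleftrightarrow> (\<exists>g. has_weak_deriv f g)"

text \<open>The weak derivative is unique only up to null sets, so this selects a representative; nothing
  below depends on which one.\<close>

definition weak_deriv :: "(real \<Rightarrow> complex) \<Rightarrow> real \<Rightarrow> complex" where
  "weak_deriv f = (SOME g. has_weak_deriv f g)"

definition q_dom :: "int \<Rightarrow> (real \<Rightarrow> complex) set" where
  "q_dom m =
     (if m \<noteq> 0
      then {f \<in> H_space. (\<lambda>\<theta>. of_real (1 / sin \<theta>) * f \<theta>) \<in> H_space \<and>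
                         weakly_differentiable f \<and> weak_deriv f \<in> H_space}
      else {f \<in> H_space. weakly_differentiable f \<and> weak_deriv f \<in> H_space})"

definition q_form :: "int \<Rightarrow> real \<Rightarrow> (real \<Rightarrow> complex) \<Rightarrow> real" where
  "q_form m b f =
     (LINT \<theta>|sphere_measure.
        (norm (weak_deriv f \<theta>))\<^sup>2 + (of_int m / sin \<theta> - b / 2)\<^sup>2 * (norm (f \<theta>))\<^sup>2)"

text \<open>Both infima below are over nonempty sets of reals bounded below by 0, so the conditionally
  complete infimum on the reals is the usual one.\<close>

definition lambda_ev :: "int \<Rightarrow> real \<Rightarrow> real" where
  "lambda_ev m b =
     (INF f \<in> {f \<in> q_dom m. \<not> (AE \<theta> in sphere_measure. f \<theta> = 0)}.
        q_form m b f / (H_norm f)\<^sup>2)"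

definition e_fun :: "real \<Rightarrow> real" where
  "e_fun b = (INF m. lambda_ev m b)"

end

theory Submission
  imports Defs
begin

text \<open>Three values of \<open>b\<close> suffice. The constant function with \<open>m = 0\<close> gives \<open>e(1) \<le> 1/4\<close>, and \<open>sin\<close> with
  \<open>m = 1\<close> gives \<open>e(12/5) \<le> 86/25 - 9\<pi>/10 < 16/25\<close>. At \<open>b = 8/5\<close>, close to the crossing of
  \<open>\<lambda>\<^sub>0\<close> and \<open>\<lambda>\<^sub>1\<close>, all forms are bounded below by \<open>b\<^sup>2/4 = 16/25\<close>: for \<open>m \<noteq> 1\<close> already the potential
  is, and for \<open>m = 1\<close> one completes the square with the logarithmic derivative of an approximate ground
  state. The integration by parts needed there uses that a weakly differentiable function is almost
  everywhere an indefinite integral of its weak derivative (du Bois-Reymond); the same lemma on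
  vanishing test integrals identifies the weak derivatives of the two trial functions.\<close>

section \<open>Smooth bump functions\<close>

text \<open>For \<open>m = 1\<close> the quotient of \<open>sin\<close> is
  \<open>2 - 3*pi*b/8 + b^2/4\<close>. It is smallest at \<open>b = 3*pi/4\<close>, which
  \<open>12/5\<close> approximates; the value there is about 0.6126. The middle point has to satisfy
  two constraints: \<open>b^2/4\<close> must exceed that value, so \<open>b\<close> lies above
  roughly 1.57, and the quotient itself pushes \<lambda>_1 below \<open>b^2/4\<close> as soon as
  \<open>b > 16/(3*pi)\<close>, about 1.70. The fraction \<open>8/5\<close> sits in this window,
  which is narrow enough that the lower bound for \<open>m = 1\<close> has to be fairly sharp. An
  upper bound costs one explicit function, but the lower bound must hold on the whole form domain. A
  member of that domain is known only up to null sets, its derivative is given only through test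
  functions, and nothing prescribes its values at the two ends of the interval. Hence the effort
  spent on producing enough test functions, on passing to an absolutely continuous representative,
  and on extracting the decay at the ends from the integrability of
  \<open>|f|^2 / sin\<close>.\<close>

lemma tendsto_power_poly_exp_neg:
  fixes p :: "real poly"
  shows "((\<lambda>y. y ^ k * poly p y * exp (- y)) \<longlongrightarrow> 0) at_top"
\<comment> \<open>The free exponent \<open>k\<close> absorbs the factor \<open>y\<close> that splits
  off with each coefficient. The application has \<open>k = 1\<close> and \<open>y = 1/x\<close>:
  the difference quotient at \<open>0\<close>.\<close>
proof (induction p arbitrary: k)
  case 0
  then show ?case by simp
next
  case (pCons a p)
  have "((\<lambda>y. a * (y ^ k / exp y) + y ^ Suc k * poly p y * exp (- y)) \<longlongrightarrow> a * 0 + 0) at_top"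
    by (intro tendsto_intros tendsto_power_div_exp_0 pCons.IH)
  then show ?case
    by (simp add: algebra_simps exp_minus divide_inverse)
qed

text \<open>The polynomial factor in \<open>1/x\<close> makes the family closed under
  differentiation, which \<open>exp (- 1 / x)\<close> alone is not.\<close>

definition flat_exp :: "real poly \<Rightarrow> real \<Rightarrow> real" where
  "flat_exp p x = (if x \<le> 0 then 0 else poly p (1 / x) * exp (- 1 / x))"

text \<open>In the variable \<open>y = 1/x\<close> one has \<open>dy/dx = - y^2\<close>, so
  \<open>p(y) * exp (- y)\<close> has derivative \<open>(p - p')(y) * y^2 * exp (- y)\<close>; the
  factor \<open>[:0, 0, 1:]\<close> is \<open>y^2\<close>. At \<open>0\<close> both one-sided
  difference quotients tend to \<open>0\<close>, since the exponential beats every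
  polynomial.\<close>

lemma flat_exp_has_derivative:
  "(flat_exp p has_real_derivative flat_exp ((p - pderiv p) * [:0, 0, 1:]) x) (at x)"
proof -
  consider "x < 0" | "x = 0" | "x > 0" by linarith
  then show ?thesis
  proof cases
    case 1
    have "((\<lambda>_. 0) has_real_derivative 0) (at x)" by simp
    then have "(flat_exp p has_real_derivative 0) (at x)"
      by (rule has_field_derivative_transform_within_open[where S="{..<0}"])
        (use 1 in \<open>auto simp: flat_exp_def\<close>)
    then show ?thesis using 1 by (simp add: flat_exp_def)
  next
    case 3
    have "((\<lambda>x. poly p (1 / x) * exp (- 1 / x)) has_real_derivative
        flat_exp ((p - pderiv p) * [:0, 0, 1:]) x) (at x)"
      using 3 by (auto intro!: derivative_eq_intros DERIV_chain2[OF poly_DERIV] simp: flat_exp_def)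
        (simp add: field_simps power2_eq_square)
    then show ?thesis
      by (rule has_field_derivative_transform_within_open[where S="{0<..}"])
        (use 3 in \<open>auto simp: flat_exp_def\<close>)
  next
    case 2
    have "((\<lambda>x. (1/x) ^ 1 * poly p (1/x) * exp (- (1/x))) \<longlongrightarrow> 0) (at_right (0::real))"
      by (rule filterlim_compose[OF tendsto_power_poly_exp_neg])
        (simp add: filterlim_inverse_at_top_right flip: inverse_eq_divide)
    then have "((\<lambda>x. flat_exp p x / x) \<longlongrightarrow> 0) (at_right (0::real))"
      by (rule Lim_transform_eventually)
        (auto simp: flat_exp_def eventually_at_filter intro!: always_eventually)
    moreover have "((\<lambda>x. flat_exp p x / x) \<longlongrightarrow> 0) (at_left (0::real))"
      by (rule Lim_transform_eventually[OF tendsto_const])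
        (auto simp: flat_exp_def eventually_at_filter intro!: always_eventually)
    ultimately have "((\<lambda>x. flat_exp p x / x) \<longlongrightarrow> 0) (at 0)"
      by (simp add: filterlim_split_at)
    then show ?thesis
      using 2 by (simp add: has_field_derivative_iff flat_exp_def[of _ 0])
  qed
qed

text \<open>An algebra of functions that is closed under \<^const>\<open>deriv\<close>, hence consists of smooth
  functions.\<close>

inductive_set flat_algebra :: "(real \<Rightarrow> real) set" where
  flat: "(\<lambda>x. flat_exp p (s * x + c)) \<in> flat_algebra"
| scale: "f \<in> flat_algebra \<Longrightarrow> (\<lambda>x. r * f x) \<in> flat_algebra"
| add: "f \<in> flat_algebra \<Longrightarrow> g \<in> flat_algebra \<Longrightarrow> (\<lambda>x. f x + g x) \<in> flat_algebra"
| mult: "f \<in> flat_algebra \<Longrightarrow> g \<in> flat_algebra \<Longrightarrow> (\<lambda>x. f x * g x) \<in> flat_algebra"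

lemma flat_algebra_has_derivative:
  "f \<in> flat_algebra \<Longrightarrow> \<exists>f'\<in>flat_algebra. \<forall>x. (f has_real_derivative f' x) (at x)"
proof (induction rule: flat_algebra.induct)
  case (flat p s c)
  let ?q = "(p - pderiv p) * [:0, 0, 1:]"
  have "((\<lambda>x. flat_exp p (s * x + c)) has_real_derivative s * flat_exp ?q (s * x + c)) (at x)" for x
    by (rule DERIV_cong[OF DERIV_chain2[OF flat_exp_has_derivative]])
      (auto intro!: derivative_eq_intros)
  moreover have "(\<lambda>x. s * flat_exp ?q (s * x + c)) \<in> flat_algebra"
    by (intro flat_algebra.intros)
  ultimately show ?case by (intro bexI[where x="\<lambda>x. s * flat_exp ?q (s * x + c)"]) auto
next
  case (scale f r)
  then obtain f' where "f' \<in> flat_algebra" "\<And>x. (f has_real_derivative f' x) (at x)" by blast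
  then show ?case
    by (intro bexI[where x="\<lambda>x. r * f' x"]) (auto intro!: DERIV_cmult flat_algebra.intros)
next
  case (add f g)
  then obtain f' g' where "f' \<in> flat_algebra" "\<And>x. (f has_real_derivative f' x) (at x)"
    "g' \<in> flat_algebra" "\<And>x. (g has_real_derivative g' x) (at x)" by blast
  then show ?case
    by (intro bexI[where x="\<lambda>x. f' x + g' x"]) (auto intro!: DERIV_add flat_algebra.intros)
next
  case (mult f g)
  then obtain f' g' where "f' \<in> flat_algebra" "\<And>x. (f has_real_derivative f' x) (at x)"
    "g' \<in> flat_algebra" "\<And>x. (g has_real_derivative g' x) (at x)" by blast
  with mult.hyps show ?case
    by (intro bexI[where x="\<lambda>x. f' x * g x + g' x * f x"]) (auto intro!: DERIV_mult flat_algebra.intros)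
qed

lemma flat_algebra_smooth:
  assumes "f \<in> flat_algebra"
  shows "(deriv ^^ k) f differentiable (at x)"
proof -
  have "deriv f \<in> flat_algebra" if f: "f \<in> flat_algebra" for f
  proof -
    obtain f' where "f' \<in> flat_algebra" "\<And>x. (f has_real_derivative f' x) (at x)"
      using flat_algebra_has_derivative[OF f] by blast
    moreover from this have "deriv f = f'" by (auto intro: DERIV_imp_deriv)
    ultimately show ?thesis by simp
  qed
  then have "(deriv ^^ k) f \<in> flat_algebra"
    using assms by (induction k) auto
  then show ?thesis
    using flat_algebra_has_derivative real_differentiable_def by blast
qed

text \<open>Increasing \<open>n\<close> steepens both flanks, so that the bumps approximate the
  indicator of the open interval. The affine arguments are written in the shape of the rule
  \<open>flat\<close>, which gives membership in \<open>flat_algebra\<close> at once.\<close>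

definition bump :: "real \<Rightarrow> real \<Rightarrow> nat \<Rightarrow> real \<Rightarrow> real" where
  "bump a b n x = flat_exp 1 (real n * x + - (real n * a)) * flat_exp 1 (- real n * x + real n * b)"

lemma bump_eq_0: "x \<notin> {a<..<b} \<Longrightarrow> bump a b n x = 0"
  by (auto simp: bump_def flat_exp_def mult_le_cancel_left)

lemma bump_bounds: "0 \<le> bump a b n x" "bump a b n x \<le> 1"
proof -
  have *: "0 \<le> flat_exp 1 y \<and> flat_exp 1 y \<le> 1" for y by (auto simp: flat_exp_def)
  show "0 \<le> bump a b n x" "bump a b n x \<le> 1"
    using * by (auto simp: bump_def intro!: mult_nonneg_nonneg mult_le_one)
qed

lemma bump_pos: "x \<in> {a<..<b} \<Longrightarrow> n > 0 \<Longrightarrow> bump a b n x > 0"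
  by (auto simp: bump_def flat_exp_def mult_le_cancel_left not_le)

lemma test_function_bump:
  assumes "0 < a" "a < b" "b < pi"
  shows "test_function (bump a b n)"
proof -
  have "bump a b n \<in> flat_algebra"
    unfolding bump_def by (intro flat_algebra.intros)
  have "closure {x. bump a b n x \<noteq> 0} \<subseteq> {a..b}"
  proof (rule closure_minimal)
    show "{x. bump a b n x \<noteq> 0} \<subseteq> {a..b}"
      using bump_eq_0[of _ a b n] greaterThanLessThan_subseteq_atLeastAtMost_iff[of a b a b] by blast
  qed simp
  then have "closure {x. bump a b n x \<noteq> 0} \<subseteq> {0<..<pi}"
    using assms by force
  then show ?thesis
    using flat_algebra_smooth[OF \<open>bump a b n \<in> flat_algebra\<close>] by (simp add: test_function_def)
qed

lemma flat_exp_tendsto_1: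
  assumes "t > 0" shows "(\<lambda>n. flat_exp 1 (real n * t)) \<longlonglongrightarrow> 1"
proof -
  have "filterlim (\<lambda>n. real n * t) at_top sequentially"
    using filterlim_at_top_mult_tendsto_pos[OF tendsto_const assms filterlim_real_sequentially]
    by (simp add: mult.commute)
  then have "(\<lambda>n. exp (- inverse (real n * t))) \<longlonglongrightarrow> exp (- 0)"
    by (intro tendsto_intros tendsto_inverse_0_at_top)
  \<comment> \<open>The equation fails at \<open>n = 0\<close>: there \<open>inverse 0 = 0\<close>
    makes the left side \<open>1\<close>, whereas \<open>flat_exp\<close> is
    \<open>0\<close>.\<close>
  moreover have "\<forall>\<^sub>F n in sequentially. exp (- inverse (real n * t)) = flat_exp 1 (real n * t)"
    using eventually_gt_at_top[of 0]
    by eventually_elim (use assms in \<open>auto simp: flat_exp_def inverse_eq_divide mult_le_0_iff\<close>)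
  ultimately show ?thesis
    by (auto intro: Lim_transform_eventually)
qed

lemma bump_tendsto: "(\<lambda>n. bump a b n x) \<longlonglongrightarrow> indicator {a<..<b} x"
proof (cases "x \<in> {a<..<b}")
  case True
  then have "(\<lambda>n. flat_exp 1 (real n * (x - a)) * flat_exp 1 (real n * (b - x))) \<longlonglongrightarrow> 1 * 1"
    by (intro tendsto_intros flat_exp_tendsto_1) auto
  then show ?thesis using True by (simp add: bump_def algebra_simps)
qed (simp add: bump_eq_0)

section \<open>Supports, derivatives and primitives of test functions\<close>

lemma test_function_support:
  assumes "test_function \<phi>"
  obtains a b where "0 < a" "a < b" "b < pi" "\<And>x. x \<notin> {a..b} \<Longrightarrow> \<phi> x = 0"
proof -
  let ?C = "closure {x. \<phi> x \<noteq> 0}"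
  have C: "?C \<subseteq> {0<..<pi}" using assms by (simp add: test_function_def)
  then have "compact ?C"
    by (metis bounded_box bounded_subset closed_closure compact_eq_bounded_closed box_real(1))
  show ?thesis
  proof (cases "?C = {}")
    case True
    then have "\<phi> x = 0" for x by auto
    then show ?thesis using that[of 1 2] pi_gt3 by auto
  next
    case False
    obtain s where s: "s \<in> ?C" "\<And>x. x \<in> ?C \<Longrightarrow> s \<le> x"
      using compact_attains_inf[OF \<open>compact ?C\<close> False] by auto
    obtain t where t: "t \<in> ?C" "\<And>x. x \<in> ?C \<Longrightarrow> x \<le> t"
      using compact_attains_sup[OF \<open>compact ?C\<close> False] by auto
    have st: "0 < s" "s \<le> t" "t < pi"
      using C s t by auto
    \<comment> \<open>Halving the lower end makes the endpoints distinct without a separate argument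
      that \<open>s < t\<close>.\<close>
    have "\<phi> x = 0" if "x \<notin> {s/2..t}" for x
    proof (rule ccontr)
      assume "\<phi> x \<noteq> 0"
      then have "x \<in> ?C" by (metis (mono_tags) closure_subset mem_Collect_eq subsetD)
      then show False using s(2)[of x] t(2)[of x] that st by auto
    qed
    then show ?thesis
      using that[of "s/2" t] st by auto
  qed
qed

text \<open>Integration by parts evaluates the test function at the endpoints, so these must
  themselves be zeros; the version with a closed interval leaves them open.\<close>

lemma test_function_support_open:
  assumes "test_function \<phi>"
  obtains a b where "0 < a" "a < b" "b < pi" "\<And>x. x \<notin> {a<..<b} \<Longrightarrow> \<phi> x = 0"
proof -
  obtain a b where ab: "0 < a" "a < b" "b < pi" "\<And>x. x \<notin> {a..b} \<Longrightarrow> \<phi> x = 0"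
    using test_function_support[OF assms] by blast
  have "\<phi> x = 0" if "x \<notin> {a/2<..<(b + pi)/2}" for x
    by (rule ab(4)) (use ab(1-3) that in \<open>auto simp: not_less\<close>)
  then show ?thesis
    using that[of "a/2" "(b + pi)/2"] ab(1-3) by auto
qed

lemma test_function_DERIV: "test_function \<phi> \<Longrightarrow> (\<phi> has_real_derivative deriv \<phi> x) (at x)"
  unfolding test_function_def DERIV_deriv_iff_real_differentiable by (metis funpow_0)

lemma test_function_continuous_on: "test_function \<phi> \<Longrightarrow> continuous_on S \<phi>"
  by (rule DERIV_continuous_on[where D="deriv \<phi>"])
    (rule has_field_derivative_at_within[OF test_function_DERIV])

lemma test_function_continuous_on_deriv: 
  assumes "test_function \<phi>" shows "continuous_on S (deriv \<phi>)"
proof -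
  have "(deriv ^^ Suc 0) \<phi> differentiable (at x)" for x
    using assms unfolding test_function_def by blast
  then show ?thesis
    by (simp add: continuous_at_imp_continuous_on differentiable_imp_continuous_within)
qed

lemma test_function_deriv_outside:
  assumes "test_function \<phi>" "\<And>x. x \<notin> {a..b} \<Longrightarrow> \<phi> x = 0" "x \<notin> {a..b}"
  shows "deriv \<phi> x = 0"
proof -
  have "((\<lambda>_. 0) has_real_derivative 0) (at x)" by simp
  then have "(\<phi> has_real_derivative 0) (at x)"
    by (rule has_field_derivative_transform_within_open[where S="-{a..b}"]) (use assms in \<open>auto simp: open_Compl\<close>)
  then show ?thesis by (rule DERIV_imp_deriv)
qed

text \<open>To the left of the support the primitive started at \<open>0\<close> vanishes in any
  case; vanishing mean is what brings it back to \<open>0\<close> on the right. Mean-zero test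
  functions are thus derivatives of test functions, which is the input for the du Bois-Reymond
  argument.\<close>

lemma test_function_antiderivative:
  assumes \<psi>: "test_function \<psi>" and int0: "integral {0..pi} \<psi> = 0"
  obtains \<phi> where "test_function \<phi>" "deriv \<phi> = \<psi>"
proof -
  obtain a b where ab: "0 < a" "a < b" "b < pi" and out: "\<And>x. x \<notin> {a..b} \<Longrightarrow> \<psi> x = 0"
    using test_function_support[OF \<psi>] by blast
  have "continuous_on UNIV \<psi>" by (rule test_function_continuous_on[OF \<psi>])
  then have "\<exists>F. \<forall>x. -\<infinity> < ereal x \<longrightarrow> ereal x < \<infinity> \<longrightarrow> (F has_vector_derivative \<psi> x) (at x)"
    by (intro einterval_antiderivative) (auto simp: continuous_on_eq_continuous_at)
  then obtain F where F: "\<And>x. (F has_real_derivative \<psi> x) (at x)"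
    by (auto simp: has_real_derivative_iff_has_vector_derivative)
  define \<phi> where "\<phi> x = F x - F 0" for x
  have d\<phi>: "(\<phi> has_real_derivative \<psi> x) (at x)" for x
    unfolding \<phi>_def using F by (auto intro!: derivative_eq_intros)
  then have deriv: "deriv \<phi> = \<psi>" by (auto intro: DERIV_imp_deriv)
  have FTC: "integral {x..y} \<psi> = F y - F x" if "x \<le> y" for x y
    by (intro integral_unique fundamental_theorem_of_calculus that)
      (metis F has_real_derivative_iff_has_vector_derivative has_vector_derivative_at_within)
  have zero: "integral S \<psi> = 0" if "S \<inter> {a..b} = {}" for S
    using that out by (subst integral_cong[where g="\<lambda>_. 0"]) (blast, simp)
  have "\<phi> x = 0" if x: "x \<notin> {a..b}" for x
  proof -
    have "x < a \<or> b < x" using x by auto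
    then consider "x \<le> 0" | "0 \<le> x" "x < a" | "b < x" "x \<le> pi" | "pi \<le> x" 
      by linarith
    then show ?thesis
    proof cases
      case 1
      then show ?thesis using FTC[of x 0] zero[of "{x..0}"] ab by (auto simp: \<phi>_def)
    next
      case 2
      then show ?thesis using FTC[of 0 x] zero[of "{0..x}"] ab by (auto simp: \<phi>_def)
    next
      case 3
      then show ?thesis using FTC[of x pi] FTC[of 0 pi] int0 zero[of "{x..pi}"] ab by (auto simp: \<phi>_def)
    next
      case 4
      then show ?thesis using FTC[of pi x] FTC[of 0 pi] int0 zero[of "{pi..x}"] ab by (auto simp: \<phi>_def)
    qed
  qed
  then have "closure {x. \<phi> x \<noteq> 0} \<subseteq> {a..b}"
    by (intro closure_minimal subsetI closed_atLeastAtMost) blast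
  moreover have "(deriv ^^ k) \<phi> differentiable (at x)" for k x
  proof (cases k)
    case 0
    then show ?thesis using d\<phi> real_differentiable_def by auto
  next
    case (Suc j)
    then have "(deriv ^^ k) \<phi> = (deriv ^^ j) \<psi>"
      by (simp add: funpow_swap1 deriv)
    then show ?thesis using \<psi> by (simp add: test_function_def)
  qed
  ultimately have "test_function \<phi>"
    using ab by (auto simp: test_function_def dest!: subsetD)
  then show ?thesis using that deriv by blast
qed

text \<open>Used to correct the mean of a test function by a multiple of a fixed one.\<close>

lemma test_function_diff_scale:
  assumes f: "test_function f" and g: "test_function g"
  shows "test_function (\<lambda>x. f x - c * g x)"
proof -
  have *: "(deriv ^^ k) (\<lambda>x. f x - c * g x) = (\<lambda>x. (deriv ^^ k) f x - c * (deriv ^^ k) g x)" for k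
  proof (induction k)
    case (Suc k)
    have "((deriv ^^ k) f has_real_derivative deriv ((deriv ^^ k) f) x) (at x)"
      "((deriv ^^ k) g has_real_derivative deriv ((deriv ^^ k) g) x) (at x)" for x
      using f g unfolding test_function_def DERIV_deriv_iff_real_differentiable by blast+
    then have "deriv (\<lambda>x. (deriv ^^ k) f x - c * (deriv ^^ k) g x) x
        = deriv ((deriv ^^ k) f) x - c * deriv ((deriv ^^ k) g) x" for x
      by (intro DERIV_imp_deriv DERIV_diff DERIV_cmult)
    then show ?case by (simp add: Suc)
  qed simp
  obtain a b where ab: "0 < a" "a < b" "b < pi" "\<And>x. x \<notin> {a..b} \<Longrightarrow> f x = 0"
    using test_function_support[OF f] by blast
  obtain a' b' where ab': "0 < a'" "a' < b'" "b' < pi" "\<And>x. x \<notin> {a'..b'} \<Longrightarrow> g x = 0"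
    using test_function_support[OF g] by blast
  have "closure {x. f x - c * g x \<noteq> 0} \<subseteq> {min a a'..max b b'}"
  proof (rule closure_minimal)
    show "{x. f x - c * g x \<noteq> 0} \<subseteq> {min a a'..max b b'}"
    proof
      fix x assume "x \<in> {x. f x - c * g x \<noteq> 0}"
      then have "f x \<noteq> 0 \<or> g x \<noteq> 0" by auto
      then have "x \<in> {a..b} \<or> x \<in> {a'..b'}" using ab(4) ab'(4) by blast
      then show "x \<in> {min a a'..max b b'}" by auto
    qed
  qed simp
  also have "\<dots> \<subseteq> {0<..<pi}" using ab ab' by auto
  finally show ?thesis
    using f g unfolding test_function_def * by (auto intro!: derivative_intros)
qed

section \<open>Integration by parts for indefinite integrals\<close>

lemma indefinite_integral_continuous:
  fixes u :: "real \<Rightarrow> complex"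
  assumes "set_integrable lebesgue {a..b} u"
    and U: "\<And>x. x \<in> {a..b} \<Longrightarrow> U x = A + (LINT t:{a..x}|lebesgue. u t)"
  shows "continuous_on {a..b} U"
proof -
  have "u integrable_on {a..b}"
    using assms(1) by (rule set_lebesgue_integral_eq_integral)
  then have "continuous_on {a..b} (\<lambda>x. A + integral {a..x} u)"
    by (intro continuous_intros indefinite_integral_continuous_1)
  moreover have "A + integral {a..x} u = U x" if "x \<in> {a..b}" for x
  proof -
    have "set_integrable lebesgue {a..x} u"
      by (rule set_integrable_subset[OF assms(1)]) (use that in auto)
    then show ?thesis
      using U[OF that] by (simp add: set_lebesgue_integral_eq_integral)
  qed
  ultimately show ?thesis by (rule continuous_on_eq)
qed

lemma set_integrable_mult_continuous:
  fixes u V :: "real \<Rightarrow> complex"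
  assumes "set_integrable lebesgue {a..b} u" "continuous_on {a..b} V"
  shows "set_integrable lebesgue {a..b} (\<lambda>x. u x * V x)"
proof -
  have "V \<in> borel_measurable (lebesgue_on {a..b})"
    using assms(2) by (simp add: continuous_imp_measurable_on_sets_lebesgue)
  moreover have "bounded (V ` {a..b})"
    by (intro compact_imp_bounded compact_continuous_image assms compact_Icc)
  ultimately show ?thesis
    using absolutely_integrable_bounded_measurable_product[of "(*)" V "{a..b}" u] assms(1)
    by (simp add: mult.commute bilinear_times)
qed

lemma sigma_finite_lebesgue: "sigma_finite_measure (lebesgue :: real measure)"
proof
  have "x \<in> (\<Union>n. {- real n..real n})" for x
    using real_arch_simple[of "\<bar>x\<bar>"] by (auto simp: abs_le_iff minus_le_iff)
  then show "\<exists>A::real set set. countable A \<and> A \<subseteq> sets lebesgue \<and> \<Union> A = space lebesgue \<and> (\<forall>a\<in>A. emeasure lebesgue a \<noteq> \<infinity>)"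
    by (intro exI[where x="range (\<lambda>n::nat. {- real n..real n})"]) (auto simp: emeasure_lborel_Icc_eq)
qed

text \<open>\<open>U\<close> and \<open>V\<close> are only absolutely continuous, so the product
  rule comes from Fubini: \<open>u x * v y\<close> is integrated over the square and split along the
  diagonal. The part \<open>y \<le> x\<close> contributes the integral of
  \<open>u * (V - B)\<close>, the part \<open>x < y\<close> that of \<open>v * (U - A)\<close>, and
  the whole square gives \<open>(U b - A) * (V b - B)\<close>. The integrability claim allows the
  product \<open>U * V\<close> to serve as a factor in a second application.\<close>

lemma integration_by_parts_indefinite:
  fixes u v :: "real \<Rightarrow> complex"
  assumes u: "set_integrable lebesgue {a..b} u" and v: "set_integrable lebesgue {a..b} v"
    and ab: "a \<le> b"
    and U: "\<And>x. x \<in> {a..b} \<Longrightarrow> U x = A + (LINT t:{a..x}|lebesgue. u t)"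
    and V: "\<And>x. x \<in> {a..b} \<Longrightarrow> V x = B + (LINT t:{a..x}|lebesgue. v t)"
  shows "(LINT t:{a..b}|lebesgue. u t * V t + v t * U t) = U b * V b - A * B"
    and "set_integrable lebesgue {a..b} (\<lambda>t. u t * V t + v t * U t)"
proof -
  interpret pair_sigma_finite "lebesgue :: real measure" "lebesgue :: real measure"
    by (simp add: pair_sigma_finite_def sigma_finite_lebesgue)
  let ?I = "indicator {a..b} :: real \<Rightarrow> real"
  define u0 v0 where "u0 x = ?I x *\<^sub>R u x" and "v0 x = ?I x *\<^sub>R v x" for x
  have iu: "integrable lebesgue u0" and iv: "integrable lebesgue v0"
    using u v by (simp_all add: set_integrable_def u0_def[abs_def] v0_def[abs_def])
  have mu[measurable]: "u0 \<in> borel_measurable lebesgue" and mv[measurable]: "v0 \<in> borel_measurable lebesgue"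
    using iu iv by auto
  have cU: "continuous_on {a..b} U" and cV: "continuous_on {a..b} V"
    by (rule indefinite_integral_continuous[OF u U], assumption, rule indefinite_integral_continuous[OF v V])
  have iuV: "set_integrable lebesgue {a..b} (\<lambda>t. u t * V t)" and ivU: "set_integrable lebesgue {a..b} (\<lambda>t. v t * U t)"
    using set_integrable_mult_continuous u v cU cV by blast+
  then show "set_integrable lebesgue {a..b} (\<lambda>t. u t * V t + v t * U t)" by (rule set_integral_add)
  define f where "f = (\<lambda>(x,y). u0 x * v0 y)"
  define f1 where "f1 = (\<lambda>(x,y). (if y \<le> x then u0 x * v0 y else 0))"
  define f2 where "f2 = (\<lambda>(x,y). (if x < y then u0 x * v0 y else 0))"
  have [measurable]: "f \<in> borel_measurable (lebesgue \<Otimes>\<^sub>M lebesgue)"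
    unfolding f_def by measurable
  \<comment> \<open>The triangles are cut out by comparing coordinates as Borel functions, while the
    product carries Lebesgue sets; the identity from the finer to the coarser structure bridges
    this.\<close>
  have [measurable]: "fst \<in> borel_measurable (lebesgue \<Otimes>\<^sub>M (lebesgue :: real measure))"
    "snd \<in> borel_measurable ((lebesgue :: real measure) \<Otimes>\<^sub>M lebesgue)"
    by (rule measurable_compose[OF measurable_fst id_borel_measurable_lebesgue, unfolded id_def],
        rule measurable_compose[OF measurable_snd id_borel_measurable_lebesgue, unfolded id_def])
  have [measurable]: "f1 \<in> borel_measurable (lebesgue \<Otimes>\<^sub>M lebesgue)"
    "f2 \<in> borel_measurable (lebesgue \<Otimes>\<^sub>M lebesgue)"
    unfolding f1_def f2_def split_beta by measurable
  have int_f: "integrable (lebesgue \<Otimes>\<^sub>M lebesgue) f"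
    by (rule Fubini_integrable) (use iu iv in \<open>auto simp: f_def norm_mult\<close>)
  have int_f1: "integrable (lebesgue \<Otimes>\<^sub>M lebesgue) f1"
    by (rule Bochner_Integration.integrable_bound[OF int_f])
      (auto simp: f1_def f_def split_beta)
  have int_f2: "integrable (lebesgue \<Otimes>\<^sub>M lebesgue) f2"
    by (rule Bochner_Integration.integrable_bound[OF int_f])
      (auto simp: f2_def f_def split_beta)
  have "f = (\<lambda>z. f1 z + f2 z)"
    by (auto simp: f_def f1_def f2_def fun_eq_iff)
  then have "integral\<^sup>L (lebesgue \<Otimes>\<^sub>M lebesgue) f = integral\<^sup>L (lebesgue \<Otimes>\<^sub>M lebesgue) f1 + integral\<^sup>L (lebesgue \<Otimes>\<^sub>M lebesgue) f2"
    using int_f1 int_f2 by simp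
  moreover have "integral\<^sup>L (lebesgue \<Otimes>\<^sub>M lebesgue) f = (LINT x:{a..b}|lebesgue. u x) * (LINT x:{a..b}|lebesgue. v x)"
    unfolding integral_fst'[OF int_f, symmetric] using iu iv
    by (simp add: f_def set_lebesgue_integral_def flip: u0_def v0_def)
  moreover have "integral\<^sup>L (lebesgue \<Otimes>\<^sub>M lebesgue) f1 = (LINT x:{a..b}|lebesgue. u x * (V x - B))"
  proof -
    have "(LINT y|lebesgue. f1 (x,y)) = ?I x *\<^sub>R (u x * (V x - B))" for x
    proof -
      have "(LINT y|lebesgue. f1 (x,y)) = (LINT y|lebesgue. u0 x * (indicator {a..x} y *\<^sub>R v y))"
        by (rule Bochner_Integration.integral_cong) (auto simp: f1_def u0_def v0_def indicator_def)
      also have "\<dots> = u0 x * (LINT y|lebesgue. (indicator {a..x} y *\<^sub>R v y))"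
        by (rule integral_mult_right_zero)
      also have "\<dots> = ?I x *\<^sub>R (u x * (V x - B))"
        using V[of x] by (auto simp: u0_def set_lebesgue_integral_def indicator_def)
      finally show ?thesis .
    qed
    then show ?thesis
      unfolding integral_fst'[OF int_f1, symmetric] set_lebesgue_integral_def by simp
  qed
  moreover have "integral\<^sup>L (lebesgue \<Otimes>\<^sub>M lebesgue) f2 = (LINT y:{a..b}|lebesgue. v y * (U y - A))"
  proof -
    have "(LINT x|lebesgue. f2 (x,y)) = ?I y *\<^sub>R (v y * (U y - A))" for y
    proof -
      have "(LINT x|lebesgue. f2 (x,y)) = (LINT x|lebesgue. v0 y * (indicator {a..y} x *\<^sub>R u x))"
      proof (rule integral_cong_AE)
        \<comment> \<open>\<open>f2\<close> leaves out the diagonal, but the closed interval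
          \<open>{a..y}\<close> contains its endpoint; one point is a null set.\<close>
        have "AE x in lebesgue. x \<noteq> y"
          by (rule AE_I[where N="{y}"]) auto
        then show "AE x in lebesgue. f2 (x,y) = v0 y * (indicator {a..y} x *\<^sub>R u x)"
          by eventually_elim (auto simp: f2_def u0_def v0_def indicator_def)
        have "(\<lambda>x. v0 y * (indicator {a..y} x *\<^sub>R u x)) = (\<lambda>x. v0 y * (indicator {a..y} x *\<^sub>R u0 x))"
          by (auto simp: u0_def v0_def indicator_def)
        also have "\<dots> \<in> borel_measurable lebesgue"
          by (intro borel_measurable_times borel_measurable_scaleR borel_measurable_indicator borel_measurable_const mu) simp
        finally show "(\<lambda>x. v0 y * (indicator {a..y} x *\<^sub>R u x)) \<in> borel_measurable lebesgue" .
      qed (use int_f2 in \<open>auto simp: f2_def\<close>)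
      also have "\<dots> = v0 y * (LINT x|lebesgue. (indicator {a..y} x *\<^sub>R u x))"
        by (rule integral_mult_right_zero)
      also have "\<dots> = ?I y *\<^sub>R (v y * (U y - A))"
        using U[of y] by (auto simp: v0_def set_lebesgue_integral_def indicator_def)
      finally show ?thesis .
    qed
    then show ?thesis
      using integral_snd[of "\<lambda>x y. f2 (x,y)"] int_f2 unfolding set_lebesgue_integral_def by simp
  qed
  ultimately have "(LINT x:{a..b}|lebesgue. u x * (V x - B)) + (LINT y:{a..b}|lebesgue. v y * (U y - A))
     = (U b - A) * (V b - B)"
    using U[of b] V[of b] ab by simp
  moreover have "(LINT x:{a..b}|lebesgue. u x * (V x - B)) = (LINT x:{a..b}|lebesgue. u x * V x) - (U b - A) * B"
    using set_integral_diff(2)[OF iuV set_integrable_mult_left[of B lebesgue "{a..b}" u]] u U[of b] ab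
    by (simp add: algebra_simps)
  moreover have "(LINT x:{a..b}|lebesgue. v x * (U x - A)) = (LINT x:{a..b}|lebesgue. v x * U x) - (V b - B) * A"
    using set_integral_diff(2)[OF ivU set_integrable_mult_left[of A lebesgue "{a..b}" v]] v V[of b] ab
    by (simp add: algebra_simps)
  ultimately show "(LINT t:{a..b}|lebesgue. u t * V t + v t * U t) = U b * V b - A * B"
    using iuV ivU by (simp add: set_integral_add) (simp add: algebra_simps)
qed

section \<open>Weak derivatives\<close>

lemma borel_eq_greaterThanLessThan_real:
  "borel = sigma UNIV (range (\<lambda>(a, b). {a<..<b :: real}))"
proof -
  have "borel = sigma UNIV (range (\<lambda>(a, b). box a b :: real set))" by (rule borel_eq_box)
  then show ?thesis by (simp add: box_real)
qed

text \<open>The sets over which \<open>h\<close> integrates to zero form a Dynkin system containing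
  the intersection-stable family of open intervals, hence all Borel sets; a Lebesgue set differs
  from a Borel set only inside a null set. The bounded support turns the integral over the line into
  one over an interval, as the complement step requires.\<close>

lemma AE_zero_if_interval_integrals_zero:
  fixes h :: "real \<Rightarrow> complex"
  assumes h: "integrable lebesgue h"
    and supp: "\<And>x. x \<notin> {\<alpha><..<\<beta>} \<Longrightarrow> h x = 0"
    and zero: "\<And>c d. (LINT x:{c<..<d}|lebesgue. h x) = 0"
  shows "AE x in lebesgue. h x = 0"
proof (rule sigma_finite_measure.density_zero[OF sigma_finite_lebesgue h])
  have si: "set_integrable lebesgue A h" if "A \<in> sets lebesgue" for A
    unfolding set_integrable_def by (rule integrable_mult_indicator[OF that h])
  let ?G = "range (\<lambda>(a, b). {a<..<b}) :: real set set"
  have UNIV: "(LINT x|lebesgue. h x) = 0"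
  proof -
    have "(LINT x|lebesgue. h x) = (LINT x:{\<alpha><..<\<beta>}|lebesgue. h x)"
      unfolding set_lebesgue_integral_def
      by (rule Bochner_Integration.integral_cong) (use supp in \<open>auto simp: indicator_def\<close>)
    then show ?thesis using zero by simp
  qed
  have borel: "(LINT x:A|lebesgue. h x) = 0" if "A \<in> sets borel" for A
  proof -
    have sub: "sigma_sets UNIV ?G \<subseteq> sets lebesgue"
    proof
      fix A assume "A \<in> sigma_sets UNIV ?G"
      then have "A \<in> sets borel" by (simp add: borel_eq_greaterThanLessThan_real)
      then show "A \<in> sets lebesgue" by (simp add: sets_completionI_sets)
    qed
    have "Int_stable ?G"
    proof (rule Int_stableI_image)
      fix i j :: "real \<times> real"
      show "\<exists>k\<in>UNIV. (case i of (a, b) \<Rightarrow> {a<..<b}) \<inter> (case j of (a, b) \<Rightarrow> {a<..<b}) = (case k of (a, b) \<Rightarrow> {a<..<b})"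
        by (intro bexI[of _ "(max (fst i) (fst j), min (snd i) (snd j))"]) (auto simp: split_beta)
    qed
    moreover have "?G \<subseteq> Pow UNIV" by simp
    moreover have "A \<in> sigma_sets UNIV ?G"
      using that by (simp add: borel_eq_greaterThanLessThan_real)
    ultimately show ?thesis
    proof (induction rule: sigma_sets_induct_disjoint)
      case (basic A)
      then show ?case using zero by auto
    next
      case empty
      then show ?case by (simp add: set_lebesgue_integral_def)
    next
      case (compl A)
      then have A: "A \<in> sets lebesgue" using sub by blast
      have "(LINT x:UNIV|lebesgue. h x) = (LINT x:A|lebesgue. h x) + (LINT x:UNIV - A|lebesgue. h x)"
        using set_integral_Un[OF _ si[OF A] si, of "UNIV - A"] A sets.compl_sets[OF A] by auto
      then show ?case
        using compl UNIV by (simp add: set_lebesgue_integral_def)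
    next
      case (union A)
      have A: "A i \<in> sets lebesgue" for i using union.hyps sub by blast
      have "(LINT x:(\<Union>i. A i)|lebesgue. h x) = (\<Sum>i. LINT x:A i|lebesgue. h x)"
      proof (rule lebesgue_integral_countable_add)
        show "A i \<inter> A j = {}" if "i \<noteq> j" for i j
          using union.hyps that by (auto simp: disjoint_family_on_def)
        show "set_integrable lebesgue (\<Union> (range A)) h" by (rule si) (use A in auto)
      qed (rule A)
      then show ?case using union.IH by simp
    qed
  qed
  fix A assume A: "A \<in> sets (lebesgue :: real measure)"
  then obtain S N N' where SN: "A = S \<union> N" "N \<subseteq> N'" "N' \<in> null_sets lborel" "S \<in> sets lborel"
    by (rule sets_completionE)
  have "(LINT x:A|lebesgue. h x) = (LINT x:S|lebesgue. h x)"
  proof (rule set_integral_cong_set)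
    have "AE x in lebesgue. x \<notin> N'"
      using SN(3) by (intro AE_not_in null_sets_completionI)
    then show "AE x in lebesgue. (x \<in> S) = (x \<in> A)"
      by eventually_elim (use SN in auto)
    show "set_borel_measurable lebesgue A h" "set_borel_measurable lebesgue S h"
      unfolding set_borel_measurable_def
      using A SN(4) si[of A] si[of S] by (auto simp: set_integrable_def dest: borel_measurable_integrable)
  qed
  then show "(LINT x:A|lebesgue. h x) = 0" using borel SN by simp
qed

lemma integral_lebesgue_on_eq_set_integral:
  fixes f :: "real \<Rightarrow> complex"
  assumes "A \<subseteq> S" "S \<in> sets lebesgue" "\<And>x. x \<notin> A \<Longrightarrow> f x = 0"
  shows "(LINT x|lebesgue_on S. f x) = (LINT x:A|lebesgue. f x)"
proof -
  have "(LINT x|lebesgue_on S. f x) = (LINT x:S|lebesgue. f x)"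
    using assms(2) by (simp add: integral_restrict_space set_lebesgue_integral_def)
  also have "\<dots> = (LINT x:A|lebesgue. f x)"
    unfolding set_lebesgue_integral_def
    by (rule Bochner_Integration.integral_cong) (use assms in \<open>auto simp: indicator_def\<close>)
  finally show ?thesis .
qed

lemma locally_integrableD:
  "locally_integrable f \<Longrightarrow> 0 < a \<Longrightarrow> b < pi \<Longrightarrow> set_integrable lebesgue {a..b} f"
  by (cases "a \<le> b") (auto simp: locally_integrable_def)

lemma set_integrable_scaleR_continuous:
  fixes f :: "real \<Rightarrow> complex"
  assumes "set_integrable lebesgue {a..b} f" "continuous_on {a..b} \<phi>"
  shows "set_integrable lebesgue {a..b} (\<lambda>x. \<phi> x *\<^sub>R f x)"
  using set_integrable_mult_continuous[OF assms(1), of "\<lambda>x. of_real (\<phi> x)"] assms(2)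
  by (simp add: continuous_on_of_real scaleR_conv_of_real mult.commute)

text \<open>Bumps converge boundedly to indicators, so by dominated convergence all integrals over
  intervals inside \<open>(0, pi)\<close> vanish. Since \<open>h\<close> may fail to be integrable
  up to the ends, \<open>AE_zero_if_interval_integrals_zero\<close> is applied to truncations whose
  supports exhaust the interval.\<close>

lemma AE_zero_if_test_integrals_zero:
  assumes h: "locally_integrable h"
    and zero: "\<And>\<phi>. test_function \<phi> \<Longrightarrow> (LINT \<theta>|lebesgue_on {0<..<pi}. \<phi> \<theta> *\<^sub>R h \<theta>) = 0"
  shows "AE x in lebesgue_on {0<..<pi}. h x = 0"
proof -
  have int0: "(LINT x:{a<..<b}|lebesgue. h x) = 0" if ab: "0 < a" "b < pi" for a b
  proof (cases "a < b")
    case True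
    have hi: "set_integrable lebesgue {a..b} h" using locally_integrableD[OF h] ab by simp
    have "(\<lambda>n. LINT x:{a..b}|lebesgue. bump a b n x *\<^sub>R h x) \<longlonglongrightarrow> (LINT x:{a<..<b}|lebesgue. h x)"
      unfolding set_lebesgue_integral_def
    proof (rule integral_dominated_convergence[where w="\<lambda>x. norm (indicator {a..b} x *\<^sub>R h x)"])
      show "(\<lambda>x. indicat_real {a<..<b} x *\<^sub>R h x) \<in> borel_measurable lebesgue"
        using set_integrable_subset[OF hi, of "{a<..<b}"] greaterThanLessThan_subseteq_atLeastAtMost_iff[of a b a b]
        by (simp add: set_integrable_def borel_measurable_integrable)
      show "(\<lambda>x. indicat_real {a..b} x *\<^sub>R bump a b n x *\<^sub>R h x) \<in> borel_measurable lebesgue" for n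
        using set_integrable_scaleR_continuous[OF hi test_function_continuous_on[OF test_function_bump[OF ab(1) True ab(2)]]]
        by (auto simp: set_integrable_def)
      show "integrable lebesgue (\<lambda>x. norm (indicat_real {a..b} x *\<^sub>R h x))"
        using hi unfolding set_integrable_def by (rule integrable_norm)
      have lim: "(\<lambda>n. indicat_real {a..b} x *\<^sub>R bump a b n x *\<^sub>R h x) \<longlonglongrightarrow> indicat_real {a..b} x *\<^sub>R indicat_real {a<..<b} x *\<^sub>R h x" for x
        by (intro tendsto_intros bump_tendsto)
      have "indicat_real {a..b} x *\<^sub>R indicat_real {a<..<b} x *\<^sub>R h x = indicat_real {a<..<b} x *\<^sub>R h x" for x
        by (auto simp: indicator_def)
      then show "AE x in lebesgue. (\<lambda>n. indicat_real {a..b} x *\<^sub>R bump a b n x *\<^sub>R h x) \<longlonglongrightarrow> indicat_real {a<..<b} x *\<^sub>R h x"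
        using lim by (intro AE_I2) (simp only:)
      show "AE x in lebesgue. norm (indicat_real {a..b} x *\<^sub>R bump a b n x *\<^sub>R h x) \<le> norm (indicat_real {a..b} x *\<^sub>R h x)" for n
        using bump_bounds[of a b n] by (auto simp: indicator_def intro!: AE_I2 mult_left_le_one_le)
    qed
    moreover have "(LINT x:{a..b}|lebesgue. bump a b n x *\<^sub>R h x) = 0" for n
    proof -
      have "(LINT x|lebesgue_on {0<..<pi}. bump a b n x *\<^sub>R h x) = (LINT x:{a..b}|lebesgue. bump a b n x *\<^sub>R h x)"
        using ab by (intro integral_lebesgue_on_eq_set_integral) (auto simp: bump_eq_0)
      then show ?thesis using zero[OF test_function_bump[OF ab(1) True ab(2)], of n] by simp
    qed
    ultimately show ?thesis by (simp add: LIMSEQ_const_iff)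
  qed (simp add: set_lebesgue_integral_def)
  have "AE x in lebesgue. indicator {1 / Suc n<..<pi - 1 / Suc n} x *\<^sub>R h x = 0" for n
  proof (rule AE_zero_if_interval_integrals_zero)
    have "set_integrable lebesgue {1 / Suc n<..<pi - 1 / Suc n} h"
      by (rule set_integrable_subset[OF locally_integrableD[OF h, of "1 / Suc n" "pi - 1 / Suc n"]]) auto
    then show "integrable lebesgue (\<lambda>x. indicat_real {1 / Suc n<..<pi - 1 / Suc n} x *\<^sub>R h x)"
      by (simp add: set_integrable_def)
    show "x \<notin> {1 / Suc n<..<pi - 1 / Suc n} \<Longrightarrow> indicat_real {1 / Suc n<..<pi - 1 / Suc n} x *\<^sub>R h x = 0" for x
      by simp
    fix c d :: real
    have "(LINT x:{c<..<d}|lebesgue. indicat_real {1 / Suc n<..<pi - 1 / Suc n} x *\<^sub>R h x)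
      = (LINT x:{max c (1 / Suc n)<..<min d (pi - 1 / Suc n)}|lebesgue. h x)"
      unfolding set_lebesgue_integral_def
      by (rule Bochner_Integration.integral_cong) (auto simp: indicator_def)
    also have "\<dots> = 0"
    proof (rule int0)
      show "0 < max c (1 / Suc n)" by (simp add: less_max_iff_disj)
      show "min d (pi - 1 / Suc n) < pi" by (simp add: min_less_iff_disj)
    qed
    finally show "(LINT x:{c<..<d}|lebesgue. indicat_real {1 / Suc n<..<pi - 1 / Suc n} x *\<^sub>R h x) = 0" .
  qed
  then have "AE x in lebesgue. \<forall>n. indicator {1 / Suc n<..<pi - 1 / Suc n} x *\<^sub>R h x = 0"
    unfolding AE_all_countable by blast
  then have "AE x in lebesgue. x \<in> {0<..<pi} \<longrightarrow> h x = 0"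
  proof eventually_elim
    case (elim x)
    show ?case
    proof
      assume x: "x \<in> {0<..<pi}"
      then obtain n where "1 / Suc n < min x (pi - x)"
        using nat_approx_posE[of "min x (pi - x)"] by auto
      then have "x \<in> {1 / Suc n<..<pi - 1 / Suc n}" by auto
      then show "h x = 0" using elim[rule_format, of n] by simp
    qed
  qed
  then show ?thesis by (simp add: AE_restrict_space_iff)
qed

section \<open>Uniqueness of weak derivatives and representation by primitives\<close>

lemma test_integral:
  assumes "test_function \<phi>" "locally_integrable f"
  shows "integrable (lebesgue_on {0<..<pi}) (\<lambda>x. \<phi> x *\<^sub>R f x)"
proof -
  obtain a b where ab: "0 < a" "a < b" "b < pi" "\<And>x. x \<notin> {a..b} \<Longrightarrow> \<phi> x = 0"
    using test_function_support[OF assms(1)] by blast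
  have "set_integrable lebesgue {a..b} (\<lambda>x. \<phi> x *\<^sub>R f x)"
    using locally_integrableD[OF assms(2), of a b] ab test_function_continuous_on[OF assms(1)]
    by (intro set_integrable_scaleR_continuous) auto
  moreover have "indicat_real {a..b} x *\<^sub>R \<phi> x *\<^sub>R f x = indicat_real {0<..<pi} x *\<^sub>R \<phi> x *\<^sub>R f x" for x
    using ab by (auto simp: indicator_def)
  ultimately show ?thesis
    by (simp only: integrable_restrict_space[of "{0<..<pi}" lebesgue, simplified] set_integrable_def)
qed

lemma locally_integrable_diff:
  "locally_integrable f \<Longrightarrow> locally_integrable g \<Longrightarrow> locally_integrable (\<lambda>x. f x - g x)"
  by (simp add: locally_integrable_def set_integral_diff)

lemma has_weak_derivD:
  assumes "has_weak_deriv f g"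
  shows "locally_integrable f" "locally_integrable g"
    and "test_function \<phi> \<Longrightarrow> (LINT \<theta>|lebesgue_on {0<..<pi}. deriv \<phi> \<theta> *\<^sub>R f \<theta>) =
        - (LINT \<theta>|lebesgue_on {0<..<pi}. \<phi> \<theta> *\<^sub>R g \<theta>)"
  using assms unfolding has_weak_deriv_def by blast+

lemma has_weak_deriv_unique:
  assumes "has_weak_deriv f g" "has_weak_deriv f g'"
  shows "AE x in lebesgue_on {0<..<pi}. g x = g' x"
proof -
  have g: "locally_integrable g" "locally_integrable g'"
    using assms by (auto simp: has_weak_deriv_def)
  have "AE x in lebesgue_on {0<..<pi}. g x - g' x = 0"
  proof (rule AE_zero_if_test_integrals_zero)
    show "locally_integrable (\<lambda>x. g x - g' x)" by (rule locally_integrable_diff[OF g])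
    fix \<phi> assume \<phi>: "test_function \<phi>"
    have "(LINT \<theta>|lebesgue_on {0<..<pi}. \<phi> \<theta> *\<^sub>R g \<theta>) = (LINT \<theta>|lebesgue_on {0<..<pi}. \<phi> \<theta> *\<^sub>R g' \<theta>)"
      using has_weak_derivD(3)[OF assms(1) \<phi>] has_weak_derivD(3)[OF assms(2) \<phi>] by simp
    then show "(LINT \<theta>|lebesgue_on {0<..<pi}. \<phi> \<theta> *\<^sub>R (g \<theta> - g' \<theta>)) = 0"
      using test_integral[OF \<phi>] g by (simp add: scaleR_diff_right)
  qed
  then show ?thesis by simp
qed

text \<open>Puts test functions and smooth weights into the form that
  \<open>integration_by_parts_indefinite\<close> expects; they become complex because the other
  factor is.\<close>

lemma has_real_derivative_imp_indefinite_integral: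
  assumes "\<And>x. x \<in> {a..b} \<Longrightarrow> (W has_real_derivative W' x) (at x)" "continuous_on {a..b} W'"
  shows "set_integrable lebesgue {a..b} (\<lambda>t. complex_of_real (W' t))"
    and "x \<in> {a..b} \<Longrightarrow> complex_of_real (W x) = of_real (W a) + (LINT t:{a..x}|lebesgue. complex_of_real (W' t))"
proof -
  show i: "set_integrable lebesgue {a..b} (\<lambda>t. complex_of_real (W' t))"
    by (intro absolutely_integrable_continuous_real continuous_on_of_real assms)
  assume x: "x \<in> {a..b}"
  have "((\<lambda>t. complex_of_real (W' t)) has_integral of_real (W x) - of_real (W a)) {a..x}"
  proof (rule fundamental_theorem_of_calculus)
    show "a \<le> x" using x by simp
    fix t assume "t \<in> {a..x}"
    then have "(W has_real_derivative W' t) (at t within {a..x})"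
      using assms(1)[of t] x by (auto intro: has_field_derivative_at_within)
    then show "((\<lambda>t. complex_of_real (W t)) has_vector_derivative of_real (W' t)) (at t within {a..x})"
      by (rule has_vector_derivative_of_real)
  qed
  moreover have "set_integrable lebesgue {a..x} (\<lambda>t. complex_of_real (W' t))"
    by (rule set_integrable_subset[OF i]) (use x in auto)
  ultimately show "complex_of_real (W x) = of_real (W a) + (LINT t:{a..x}|lebesgue. complex_of_real (W' t))"
    by (simp add: set_lebesgue_integral_eq_integral integral_unique)
qed

text \<open>The primitive is described by its increments on compact subintervals. This fits both a
  C1 function and the primitive of a merely locally integrable weak derivative, which may have no
  limit at the ends.\<close>

lemma test_function_by_parts:
  assumes \<phi>: "test_function \<phi>" and g: "locally_integrable g"
    and G: "\<And>x y. 0 < x \<Longrightarrow> x \<le> y \<Longrightarrow> y < pi \<Longrightarrow> G y = G x + (LINT t:{x..y}|lebesgue. g t)"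
  shows "(LINT \<theta>|lebesgue_on {0<..<pi}. deriv \<phi> \<theta> *\<^sub>R G \<theta>) =
        - (LINT \<theta>|lebesgue_on {0<..<pi}. \<phi> \<theta> *\<^sub>R g \<theta>)"
proof -
  obtain a b where ab: "0 < a" "a < b" "b < pi" and out: "\<And>x. x \<notin> {a<..<b} \<Longrightarrow> \<phi> x = 0"
    using test_function_support_open[OF \<phi>] by blast
  have out': "deriv \<phi> x = 0" if "x \<notin> {a..b}" for x
    by (rule test_function_deriv_outside[OF \<phi> _ that]) (use out in auto)
  have gi: "set_integrable lebesgue {a..b} g"
    using locally_integrableD[OF g] ab by simp
  have GI: "\<And>x. x \<in> {a..b} \<Longrightarrow> G x = G a + (LINT t:{a..x}|lebesgue. g t)"
    by (rule G) (use ab in auto)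
  note \<phi>I = has_real_derivative_imp_indefinite_integral[where W=\<phi> and W'="deriv \<phi>" and a=a and b=b,
      OF test_function_DERIV[OF \<phi>] test_function_continuous_on_deriv[OF \<phi>]]
  note P = integration_by_parts_indefinite[OF \<phi>I(1) gi less_imp_le[OF ab(2)] \<phi>I(2) GI]
  have "set_integrable lebesgue {a..b} (\<lambda>t. complex_of_real (deriv \<phi> t) * G t)"
    by (rule set_integrable_mult_continuous[OF \<phi>I(1) indefinite_integral_continuous[OF gi GI]])
  moreover have "set_integrable lebesgue {a..b} (\<lambda>t. g t * complex_of_real (\<phi> t))"
    using test_function_continuous_on[OF \<phi>] gi by (intro set_integrable_mult_continuous continuous_on_of_real)
  ultimately have "(LINT t:{a..b}|lebesgue. complex_of_real (deriv \<phi> t) * G t) + (LINT t:{a..b}|lebesgue. g t * complex_of_real (\<phi> t)) = 0"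
    using P(1) out[of a] out[of b] by (simp add: set_integral_add)
  moreover have "(LINT \<theta>|lebesgue_on {0<..<pi}. deriv \<phi> \<theta> *\<^sub>R G \<theta>) = (LINT t:{a..b}|lebesgue. complex_of_real (deriv \<phi> t) * G t)"
    using ab out' by (subst integral_lebesgue_on_eq_set_integral[of "{a..b}"]) (auto simp: scaleR_conv_of_real)
  moreover have "(LINT \<theta>|lebesgue_on {0<..<pi}. \<phi> \<theta> *\<^sub>R g \<theta>) = (LINT t:{a..b}|lebesgue. g t * complex_of_real (\<phi> t))"
    using ab out by (subst integral_lebesgue_on_eq_set_integral[of "{a..b}"]) (auto simp: scaleR_conv_of_real mult.commute)
  ultimately show ?thesis by (simp add: add_eq_0_iff)
qed

lemma locally_integrable_continuous: 
  "continuous_on {0<..<pi} f \<Longrightarrow> locally_integrable f"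
  unfolding locally_integrable_def
  by (auto intro!: absolutely_integrable_continuous_real elim: continuous_on_subset)

lemma has_weak_deriv_C1:
  assumes "\<And>x. (W has_real_derivative W' x) (at x)" "continuous_on UNIV W'"
  shows "has_weak_deriv (\<lambda>x. of_real (W x)) (\<lambda>x. of_real (W' x))"
proof -
  have c: "continuous_on S W'" for S using assms(2) continuous_on_subset by blast
  have "continuous_on S W" for S
    by (rule DERIV_continuous_on[where D=W']) (rule has_field_derivative_at_within[OF assms(1)])
  with c have l: "locally_integrable (\<lambda>x. of_real (W x))" "locally_integrable (\<lambda>x. of_real (W' x))"
    by (auto intro!: locally_integrable_continuous continuous_on_of_real)
  show ?thesis
    unfolding has_weak_deriv_def
  proof (intro conjI l allI impI)
    fix \<phi> assume \<phi>: "test_function \<phi>"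
    show "(LINT \<theta>|lebesgue_on {0<..<pi}. deriv \<phi> \<theta> *\<^sub>R of_real (W \<theta>)) =
        - (LINT \<theta>|lebesgue_on {0<..<pi}. \<phi> \<theta> *\<^sub>R complex_of_real (W' \<theta>))"
    proof (rule test_function_by_parts[where G="\<lambda>x. complex_of_real (W x)", OF \<phi> l(2)])
      fix x y :: real assume "x \<le> y"
      show "complex_of_real (W y) = of_real (W x) + (LINT t:{x..y}|lebesgue. complex_of_real (W' t))"
        by (rule has_real_derivative_imp_indefinite_integral(2)[where W=W and W'=W' and a=x and b=y and x=y])
          (rule assms(1), rule c, use \<open>x \<le> y\<close> in simp)
    qed
  qed
qed

text \<open>If \<open>G\<close> is a primitive of \<open>g\<close>, then \<open>h = f - G\<close>
  integrates to zero against derivatives of test functions, hence against test functions of mean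
  zero. Any test function becomes one after subtracting a multiple of a fixed \<rho>, and so
  \<open>h - C\<close> is annihilated by all of them, where \<open>C\<close> is the \<rho>-average
  of \<open>h\<close>.\<close>

lemma weak_deriv_indefinite_integral:
  assumes "has_weak_deriv f g"
  obtains F where "\<And>x y. 0 < x \<Longrightarrow> x \<le> y \<Longrightarrow> y < pi \<Longrightarrow> F y = F x + (LINT t:{x..y}|lebesgue. g t)"
    and "AE x in lebesgue_on {0<..<pi}. f x = F x"
proof -
  note lf = has_weak_derivD(1)[OF assms] and lg = has_weak_derivD(2)[OF assms] and fg = has_weak_derivD(3)[OF assms]
  \<comment> \<open>Anchored in the interior because \<open>g\<close> need not be integrable near
    the ends. Integrals over empty or one-point intervals are \<open>0\<close>, so at most one term
    survives and the difference is the oriented integral from \<open>pi/2\<close> to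
    \<open>x\<close>.\<close>
  define G where "G x = integral {pi/2..x} g - integral {x..pi/2} g" for x
  have gi: "g integrable_on {x..y}" if "0 < x" "y < pi" for x y
    by (rule set_lebesgue_integral_eq_integral(1)[OF locally_integrableD[OF lg that]])
  have G: "G y = G x + (LINT t:{x..y}|lebesgue. g t)" if xy: "0 < x" "x \<le> y" "y < pi" for x y
  proof -
    have eq: "(LINT t:{x..y}|lebesgue. g t) = integral {x..y} g"
      by (rule set_lebesgue_integral_eq_integral(2)) (use locally_integrableD[OF lg] xy in auto)
    have null: "integral {s..t} g = 0" if "t \<le> s" for s t :: real
      using that by (cases "s = t") auto
    have split: "integral {r..s} g + integral {s..t} g = integral {r..t} g"
      if "0 < r" "r \<le> s" "s \<le> t" "t < pi" for r s t
      using that by (intro Henstock_Kurzweil_Integration.integral_combine gi)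
    consider "pi/2 \<le> x" | "x < pi/2" "pi/2 \<le> y" | "y < pi/2" by linarith
    then show ?thesis
    proof cases
      case 1
      have "integral {x..pi/2} g = 0" "integral {y..pi/2} g = 0"
        "integral {pi/2..x} g + integral {x..y} g = integral {pi/2..y} g"
        by (rule null[of "pi/2" x], use 1 xy in linarith)
          ((rule null[of "pi/2" y], use 1 xy in linarith), (rule split[of "pi/2" x y]; use 1 xy pi_gt_zero in linarith))
      then show ?thesis unfolding G_def eq by simp
    next
      case 2
      have "integral {pi/2..x} g = 0" "integral {y..pi/2} g = 0"
        "integral {x..y} g = integral {x..pi/2} g + integral {pi/2..y} g"
        by (rule null[of x "pi/2"], use 2 xy in linarith)
          ((rule null[of "pi/2" y], use 2 xy in linarith), (rule split[of x "pi/2" y, symmetric]; use 2 xy pi_gt_zero in linarith))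
      then show ?thesis unfolding G_def eq by (simp add: algebra_simps)
    next
      case 3
      have "integral {pi/2..x} g = 0" "integral {pi/2..y} g = 0"
        "integral {x..pi/2} g = integral {x..y} g + integral {y..pi/2} g"
        by (rule null[of x "pi/2"], use 3 xy in linarith)
          ((rule null[of y "pi/2"], use 3 xy in linarith), (rule split[of x y "pi/2", symmetric]; use 3 xy pi_gt_zero in linarith))
      then show ?thesis unfolding G_def eq by (simp add: algebra_simps)
    qed
  qed
  have lG: "locally_integrable G"
    unfolding locally_integrable_def
  proof (intro allI impI)
    fix a b :: real assume ab: "0 < a" "a \<le> b" "b < pi"
    have "continuous_on {a..b} G"
      by (rule indefinite_integral_continuous[OF locally_integrableD[OF lg, of a b] G]) (use ab in auto)
    then show "set_integrable lebesgue {a..b} G" by (rule absolutely_integrable_continuous_real)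
  qed
  define h where "h x = f x - G x" for x
  have lh: "locally_integrable h" 
    unfolding h_def by (rule locally_integrable_diff[OF lf lG])
  have h0: "(LINT \<theta>|lebesgue_on {0<..<pi}. \<psi> \<theta> *\<^sub>R h \<theta>) = 0"
    if "test_function \<phi>" "test_function \<psi>" "\<psi> = deriv \<phi>" for \<phi> \<psi>
    using test_integral[OF that(2) lf] test_integral[OF that(2) lG]
      fg[OF that(1)] test_function_by_parts[OF that(1) lg G]
    by (simp add: h_def scaleR_diff_right flip: that(3))
  define \<rho> where "\<rho> = bump 1 2 1"
  have \<rho>: "test_function \<rho>" unfolding \<rho>_def by (rule test_function_bump) (use pi_gt3 in auto)
  define I where "I = integral {0..pi} \<rho>"
  \<comment> \<open>A continuous nonnegative function with zero integral would vanish everywhere,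
    but the bump is positive at \<open>3/2\<close>.\<close>
  have "I \<noteq> 0"
  proof
    assume "I = 0"
    then have "\<rho> (3/2) = 0"
      unfolding I_def
      using has_integral_0_cbox_imp_0[of 0 pi \<rho> "3/2"] test_function_continuous_on[OF \<rho>] bump_bounds[of 1 2 1] pi_gt3
        integrable_integral[OF integrable_continuous_real[OF test_function_continuous_on[OF \<rho>]], of 0 pi]
      by (auto simp: \<rho>_def)
    then show False using bump_pos[of "3/2" 1 2 1] by (simp add: \<rho>_def)
  qed
  define C where "C = (LINT \<theta>|lebesgue_on {0<..<pi}. \<rho> \<theta> *\<^sub>R h \<theta>) / of_real I"
  have lC: "locally_integrable (\<lambda>x. C)" by (rule locally_integrable_continuous) simp
  have "AE x in lebesgue_on {0<..<pi}. h x - C = 0"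
  proof (rule AE_zero_if_test_integrals_zero)
    show "locally_integrable (\<lambda>x. h x - C)" by (rule locally_integrable_diff[OF lh lC])
    fix \<psi> assume \<psi>: "test_function \<psi>"
    define c where "c = integral {0..pi} \<psi> / I"
    have t: "test_function (\<lambda>x. \<psi> x - c * \<rho> x)" by (rule test_function_diff_scale[OF \<psi> \<rho>])
    have "integral {0..pi} (\<lambda>x. \<psi> x - c * \<rho> x) = 0"
      using \<open>I \<noteq> 0\<close> test_function_continuous_on[OF \<psi>] test_function_continuous_on[OF \<rho>]
      by (subst Henstock_Kurzweil_Integration.integral_diff)
        (auto intro!: integrable_continuous_real continuous_intros simp: c_def simp flip: I_def)
    from test_function_antiderivative[OF t this] obtain \<phi> where \<phi>: "test_function \<phi>" "deriv \<phi> = (\<lambda>x. \<psi> x - c * \<rho> x)" .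
    have "(LINT \<theta>|lebesgue_on {0<..<pi}. (\<psi> \<theta> - c * \<rho> \<theta>) *\<^sub>R h \<theta>) = 0"
      by (rule h0[OF \<phi>(1) t \<phi>(2)[symmetric]])
    moreover have "(\<psi> x - c * \<rho> x) *\<^sub>R h x = \<psi> x *\<^sub>R h x - c *\<^sub>R (\<rho> x *\<^sub>R h x)" for x
      by (simp add: algebra_simps)
    ultimately have 1: "(LINT \<theta>|lebesgue_on {0<..<pi}. \<psi> \<theta> *\<^sub>R h \<theta>) = of_real c * (C * of_real I)"
      using test_integral[OF \<psi> lh] test_integral[OF \<rho> lh] \<open>I \<noteq> 0\<close> by (simp add: C_def scaleR_conv_of_real)
    obtain a b where ab: "0 < a" "a < b" "b < pi" "\<And>x. x \<notin> {a..b} \<Longrightarrow> \<psi> x = 0"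
      using test_function_support[OF \<psi>] by blast
    have ci: "set_integrable lebesgue {0..pi} \<psi>"
      by (rule absolutely_integrable_continuous_real[OF test_function_continuous_on[OF \<psi>]])
    have "(LINT \<theta>|lebesgue_on {0<..<pi}. \<psi> \<theta> *\<^sub>R C) = (LINT \<theta>|lebesgue_on {0..pi}. \<psi> \<theta> *\<^sub>R C)"
      using ab by (subst (1 2) integral_lebesgue_on_eq_set_integral[of "{a..b}"]) auto
    also have "\<dots> = (LINT \<theta>:{0..pi}|lebesgue. \<psi> \<theta>) *\<^sub>R C"
      using ci by (subst integral_scaleR_left) (auto simp: integral_restrict_space integrable_restrict_space set_integrable_def set_lebesgue_integral_def)
    also have "(LINT \<theta>:{0..pi}|lebesgue. \<psi> \<theta>) = integral {0..pi} \<psi>"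
      by (rule set_lebesgue_integral_eq_integral[OF ci])
    finally have 2: "(LINT \<theta>|lebesgue_on {0<..<pi}. \<psi> \<theta> *\<^sub>R C) = of_real (c * I) * C"
      using \<open>I \<noteq> 0\<close> by (simp add: c_def scaleR_conv_of_real)
    show "(LINT \<theta>|lebesgue_on {0<..<pi}. \<psi> \<theta> *\<^sub>R (h \<theta> - C)) = 0"
      using test_integral[OF \<psi> lh] test_integral[OF \<psi> lC] 1 2 by (simp add: scaleR_diff_right)
  qed
  then have "AE x in lebesgue_on {0<..<pi}. f x = G x + C"
    by eventually_elim (simp add: h_def algebra_simps)
  moreover have "G y + C = G x + C + (LINT t:{x..y}|lebesgue. g t)" if "0 < x" "x \<le> y" "y < pi" for x y
    unfolding G[OF that] by (simp add: add.commute add.left_commute)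
  ultimately show ?thesis using that[of "\<lambda>x. G x + C"] by blast
qed

section \<open>The weighted space on the interval\<close>

abbreviation interval_measure :: "real measure" where
  "interval_measure \<equiv> lebesgue_on {0<..<pi}"

lemma AE_interval: "(\<And>\<theta>. 0 < \<theta> \<Longrightarrow> \<theta> < pi \<Longrightarrow> P \<theta>) \<Longrightarrow> AE \<theta> in interval_measure. P \<theta>"
  by (rule AE_I2) simp

lemma sin_measurable [measurable]: "sin \<in> borel_measurable interval_measure"
  by (intro continuous_imp_measurable_on_sets_lebesgue continuous_intros) auto

lemma AE_sin_nonneg: "AE \<theta> in interval_measure. 0 \<le> sin \<theta>"
  by (rule AE_interval) (simp add: sin_gt_zero less_imp_le)

lemma AE_sphere_measure: "(AE \<theta> in sphere_measure. P \<theta>) \<longleftrightarrow> (AE \<theta> in interval_measure. P \<theta>)"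
proof -
  have "(AE \<theta> in sphere_measure. P \<theta>) \<longleftrightarrow> (AE \<theta> in interval_measure. 0 < ennreal (sin \<theta>) \<longrightarrow> P \<theta>)"
    unfolding sphere_measure_def by (rule AE_density) simp
  also have "\<dots> \<longleftrightarrow> (AE \<theta> in interval_measure. P \<theta>)"
    by (rule AE_cong) (simp add: sin_gt_zero)
  finally show ?thesis .
qed

lemma integrable_sphere_measure:
  fixes f :: "real \<Rightarrow> real"
  assumes "f \<in> borel_measurable interval_measure"
  shows "integrable sphere_measure f \<longleftrightarrow> integrable interval_measure (\<lambda>\<theta>. sin \<theta> * f \<theta>)"
  using integrable_density[OF assms sin_measurable AE_sin_nonneg] by (simp add: sphere_measure_def)

lemma integral_sphere_measure:
  fixes f :: "real \<Rightarrow> real"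
  assumes "f \<in> borel_measurable interval_measure"
  shows "(LINT \<theta>|sphere_measure. f \<theta>) = (LINT \<theta>|interval_measure. sin \<theta> * f \<theta>)"
  using integral_density[OF assms sin_measurable AE_sin_nonneg] by (simp add: sphere_measure_def)

lemma H_space_iff:
  "f \<in> H_space \<longleftrightarrow> f \<in> borel_measurable interval_measure \<and>
     integrable interval_measure (\<lambda>\<theta>. sin \<theta> * (norm (f \<theta>))\<^sup>2)"
proof -
  have "f \<in> borel_measurable sphere_measure \<longleftrightarrow> f \<in> borel_measurable interval_measure"
    by (simp add: measurable_def sphere_measure_def)
  moreover have "integrable sphere_measure (\<lambda>\<theta>. (norm (f \<theta>))\<^sup>2) \<longleftrightarrow>
      integrable interval_measure (\<lambda>\<theta>. sin \<theta> * (norm (f \<theta>))\<^sup>2)"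
    if "f \<in> borel_measurable interval_measure"
    using that by (intro integrable_sphere_measure) measurable
  ultimately show ?thesis by (auto simp: H_space_def)
qed

lemma H_norm_square:
  assumes "f \<in> H_space"
  shows "(H_norm f)\<^sup>2 = (LINT \<theta>|interval_measure. sin \<theta> * (norm (f \<theta>))\<^sup>2)"
proof -
  have [measurable]: "f \<in> borel_measurable interval_measure" using assms by (simp add: H_space_iff)
  have "(H_norm f)\<^sup>2 = (LINT \<theta>|sphere_measure. (norm (f \<theta>))\<^sup>2)"
    by (simp add: H_norm_def)
  then show ?thesis by (subst (asm) integral_sphere_measure) auto
qed

lemma H_norm_pos:
  assumes "f \<in> H_space" "\<not> (AE \<theta> in sphere_measure. f \<theta> = 0)"
  shows "0 < (H_norm f)\<^sup>2"
proof -
  have "integrable sphere_measure (\<lambda>\<theta>. (norm (f \<theta>))\<^sup>2)" using assms(1) by (simp add: H_space_def)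
  then have "(LINT \<theta>|sphere_measure. (norm (f \<theta>))\<^sup>2) = 0 \<longleftrightarrow> (AE \<theta> in sphere_measure. (norm (f \<theta>))\<^sup>2 = 0)"
    by (intro integral_nonneg_eq_0_iff_AE) auto
  then have "(LINT \<theta>|sphere_measure. (norm (f \<theta>))\<^sup>2) \<noteq> 0"
    using assms(2) by simp
  moreover have "0 \<le> (LINT \<theta>|sphere_measure. (norm (f \<theta>))\<^sup>2)" by simp
  ultimately show ?thesis by (simp only: H_norm_def real_sqrt_pow2 less_le not_sym simp_thms)
qed

lemma locally_integrable_measurable:
  assumes "locally_integrable f"
  shows "f \<in> borel_measurable interval_measure"
proof (rule borel_measurable_LIMSEQ_metric)
  let ?K = "\<lambda>n::nat. {1 / Suc n..pi - 1 / Suc n}"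
  show "(\<lambda>x. indicator (?K n) x *\<^sub>R f x) \<in> borel_measurable interval_measure" for n
  proof (rule measurable_restrict_space1)
    have "set_integrable lebesgue (?K n) f" by (rule locally_integrableD[OF assms]) auto
    then show "(\<lambda>x. indicator (?K n) x *\<^sub>R f x) \<in> borel_measurable lebesgue"
      by (simp add: set_integrable_def borel_measurable_integrable)
  qed
  fix x assume "x \<in> space interval_measure"
  then have "0 < min x (pi - x)" by simp
  then obtain n0 where n0: "1 / Suc n0 < min x (pi - x)" by (rule nat_approx_posE)
  have "\<forall>\<^sub>F n in sequentially. indicator (?K n) x *\<^sub>R f x = f x"
    using eventually_ge_at_top[of n0]
  proof eventually_elim
    case (elim n)
    then have "1 / Suc n \<le> 1 / Suc n0" by (simp add: frac_le)
    then have "x \<in> ?K n" using n0 by auto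
    then show ?case by simp
  qed
  then show "(\<lambda>n. indicator (?K n) x *\<^sub>R f x) \<longlonglongrightarrow> f x"
    by (rule tendsto_eventually)
qed

section \<open>Decay at the ends and vanishing boundary terms\<close>

text \<open>Otherwise \<open>h\<close> would stay above \<epsilon> near \<open>0\<close>, and
  \<open>h \<theta> / \<theta>\<close> would dominate the non-integrable
  \<open>\<epsilon> / \<theta>\<close>.\<close>

lemma exists_small_near_0:
  fixes h :: "real \<Rightarrow> real"
  assumes h: "set_integrable lebesgue {0<..<\<delta>} (\<lambda>\<theta>. h \<theta> / \<theta>)" and "0 < \<delta>" "0 < \<epsilon>"
  obtains x where "0 < x" "x < \<delta>" "h x < \<epsilon>"
proof -
  have "\<exists>x. 0 < x \<and> x < \<delta> \<and> h x < \<epsilon>"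
  proof (rule ccontr)
    assume "\<not> ?thesis"
    then have ge: "\<epsilon> \<le> h x" if "0 < x" "x < \<delta>" for x using that by force
    define I where "I = (LINT \<theta>:{0<..<\<delta>}|lebesgue. h \<theta> / \<theta>)"
    have "0 \<le> I"
      unfolding I_def set_lebesgue_integral_def
    proof (rule Bochner_Integration.integral_nonneg)
      fix \<theta>
      have "0 \<le> h \<theta> / \<theta>" if "0 < \<theta>" "\<theta> < \<delta>"
        using ge[OF that] that \<open>0 < \<epsilon>\<close> by simp
      then show "0 \<le> indicat_real {0<..<\<delta>} \<theta> *\<^sub>R (h \<theta> / \<theta>)"
        by (simp add: indicator_def)
    qed
    \<comment> \<open>Chosen so that \<epsilon> times the logarithm of \<open>\<delta> / t\<close>
      equals \<open>I + \<epsilon>\<close>, more than the whole integral \<open>I\<close>.\<close>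
    define t where "t = \<delta> * exp (- (I / \<epsilon> + 1))"
    have "0 \<le> I / \<epsilon>" using \<open>0 < \<epsilon>\<close> \<open>0 \<le> I\<close> by simp
    then have "exp (- (I / \<epsilon> + 1)) < 1" unfolding exp_less_one_iff by linarith
    then have t: "0 < t" "t < \<delta>"
      unfolding t_def using \<open>0 < \<delta>\<close> by simp_all
    have FTC: "((\<lambda>\<theta>. \<epsilon> / \<theta>) has_integral \<epsilon> * ln \<delta> - \<epsilon> * ln t) {t..\<delta>}"
      using t by (intro fundamental_theorem_of_calculus)
        (auto intro!: derivative_eq_intros simp flip: has_real_derivative_iff_has_vector_derivative)
    have c: "set_integrable lebesgue {t..\<delta>} (\<lambda>\<theta>. \<epsilon> / \<theta>)"
      using t by (intro absolutely_integrable_continuous_real continuous_intros) auto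
    have "\<epsilon> * ln \<delta> - \<epsilon> * ln t = (LINT \<theta>:{t..\<delta>}|lebesgue. \<epsilon> / \<theta>)"
      using set_lebesgue_integral_eq_integral(2)[OF c] integral_unique[OF FTC] by simp
    also have "\<dots> \<le> I"
      unfolding I_def set_lebesgue_integral_def
    proof (rule integral_mono_AE)
      show "integrable lebesgue (\<lambda>\<theta>. indicat_real {t..\<delta>} \<theta> *\<^sub>R (\<epsilon> / \<theta>))"
        "integrable lebesgue (\<lambda>\<theta>. indicat_real {0<..<\<delta>} \<theta> *\<^sub>R (h \<theta> / \<theta>))"
        using c h by (simp_all add: set_integrable_def)
      have "AE \<theta> in lebesgue. \<theta> \<noteq> \<delta>"
        by (rule AE_I[where N="{\<delta>}"]) auto
      then show "AE \<theta> in lebesgue. indicat_real {t..\<delta>} \<theta> *\<^sub>R (\<epsilon> / \<theta>) \<le> indicat_real {0<..<\<delta>} \<theta> *\<^sub>R (h \<theta> / \<theta>)"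
      proof eventually_elim
        case (elim \<theta>)
        show ?case
        proof (cases "0 < \<theta> \<and> \<theta> < \<delta>")
          case True
          then have "\<epsilon> / \<theta> \<le> h \<theta> / \<theta>" "0 \<le> h \<theta> / \<theta>"
            using ge[of \<theta>] \<open>0 < \<epsilon>\<close> by (auto intro: divide_right_mono divide_nonneg_pos)
          then show ?thesis using True by (simp add: indicator_def)
        qed (use elim t in \<open>auto simp: indicator_def\<close>)
      qed
    qed
    also have "\<epsilon> * ln \<delta> - \<epsilon> * ln t = I + \<epsilon>"
      using \<open>0 < \<delta>\<close> \<open>0 < \<epsilon>\<close> by (simp add: t_def ln_mult field_simps)
    finally show False using \<open>0 < \<epsilon>\<close> by simp
  qed
  then show ?thesis using that by blast
qed

text \<open>This is the fundamental theorem for \<open>W * |F|^2\<close>, by two applications of the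
  product rule: first to \<open>F\<close> and its conjugate, whose product has density
  \<open>p = 2 * Re (cnj F * g)\<close>, then to that product and \<open>W\<close>.\<close>

lemma indefinite_integral_abs_square:
  fixes F g :: "real \<Rightarrow> complex" and W W' :: "real \<Rightarrow> real"
  assumes g: "set_integrable lebesgue {x..y} g" and "x \<le> y"
    and F: "\<And>t. t \<in> {x..y} \<Longrightarrow> F t = F x + (LINT s:{x..t}|lebesgue. g s)"
    and W: "\<And>t. (W has_real_derivative W' t) (at t)" and W': "continuous_on UNIV W'"
  shows "(LINT t:{x..y}|lebesgue. 2 * W t * Re (cnj (F t) * g t) + W' t * (norm (F t))\<^sup>2) =
    (norm (F y))\<^sup>2 * W y - (norm (F x))\<^sup>2 * W x"
proof -
  have gc: "set_integrable lebesgue {x..y} (\<lambda>t. cnj (g t))"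
    using g Bochner_Integration.integrable_cnj[of lebesgue "\<lambda>t. indicat_real {x..y} t *\<^sub>R g t"]
    by (simp add: set_integrable_def)
  have Fc: "cnj (F t) = cnj (F x) + (LINT s:{x..t}|lebesgue. cnj (g s))" if "t \<in> {x..y}" for t
  proof -
    have "(LINT s:{x..t}|lebesgue. cnj (g s)) = cnj (LINT s:{x..t}|lebesgue. g s)"
      using Bochner_Integration.integral_cnj[of lebesgue "\<lambda>s. indicat_real {x..t} s *\<^sub>R g s"] by (simp add: set_lebesgue_integral_def)
    then show ?thesis using F[OF that] by simp
  qed
  define P where "P t = F t * cnj (F t)" for t
  define p where "p t = g t * cnj (F t) + cnj (g t) * F t" for t
  have p: "set_integrable lebesgue {x..y} p"
    unfolding p_def by (rule integration_by_parts_indefinite(2)[OF g gc \<open>x \<le> y\<close> F Fc])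
  have P: "P t = P x + (LINT s:{x..t}|lebesgue. p s)" if t: "t \<in> {x..y}" for t
  proof -
    have sub: "{x..t} \<subseteq> {x..y}" using t by auto
    have "(LINT s:{x..t}|lebesgue. p s) = F t * cnj (F t) - F x * cnj (F x)"
      unfolding p_def
    proof (rule integration_by_parts_indefinite(1))
      show "set_integrable lebesgue {x..t} g" "set_integrable lebesgue {x..t} (\<lambda>t. cnj (g t))"
        using set_integrable_subset[OF g _ sub] set_integrable_subset[OF gc _ sub] by auto
      show "x \<le> t" using t by simp
      show "F s = F x + (LINT r:{x..s}|lebesgue. g r)" if "s \<in> {x..t}" for s
        by (rule F) (use that sub in auto)
      show "cnj (F s) = cnj (F x) + (LINT r:{x..s}|lebesgue. cnj (g r))" if "s \<in> {x..t}" for s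
        by (rule Fc) (use that sub in auto)
    qed
    then show ?thesis by (simp add: P_def)
  qed
  have c: "continuous_on {x..y} W'" using W' continuous_on_subset by blast
  note WI = has_real_derivative_imp_indefinite_integral[where W=W and W'=W' and a=x and b=y, OF W c]
  have "(LINT t:{x..y}|lebesgue. p t * of_real (W t) + of_real (W' t) * P t) = P y * of_real (W y) - P x * of_real (W x)"
    by (rule integration_by_parts_indefinite(1)[OF p WI(1) \<open>x \<le> y\<close> P WI(2)])
  moreover have "p t * of_real (W t) + of_real (W' t) * P t =
      of_real (2 * W t * Re (cnj (F t) * g t) + W' t * (norm (F t))\<^sup>2)" for t
    unfolding p_def P_def cmod_power2 by (simp add: complex_eq_iff algebra_simps power2_eq_square)
  moreover have "P t * of_real (W t) = of_real ((norm (F t))\<^sup>2 * W t)" for t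
    unfolding P_def of_real_mult complex_norm_square by (rule refl)
  ultimately have "complex_of_real (LINT t:{x..y}|lebesgue. 2 * W t * Re (cnj (F t) * g t) + W' t * (norm (F t))\<^sup>2)
     = of_real ((norm (F y))\<^sup>2 * W y - (norm (F x))\<^sup>2 * W x)"
    by (simp only: set_integral_complex_of_real of_real_diff)
  then show ?thesis by (simp only: of_real_eq_iff)
qed

text \<open>Moves the end \<open>pi\<close> to \<open>0\<close>, so that a single smallness argument
  serves both ends.\<close>

lemma integrable_reflect_interval:
  fixes f :: "real \<Rightarrow> real"
  assumes "set_integrable lebesgue {0<..<pi} f"
  shows "set_integrable lebesgue {0<..<pi} (\<lambda>\<theta>. f (pi - \<theta>))"
proof -
  have "integrable lebesgue (\<lambda>\<theta>. indicat_real {0<..<pi} (pi + (-1) * \<theta>) *\<^sub>R f (pi + (-1) * \<theta>))"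
    using assms unfolding set_integrable_def by (intro lebesgue_integrable_real_affine) auto
  moreover have "indicat_real {0<..<pi} (pi + (-1) * \<theta>) = indicat_real {0<..<pi} \<theta>" for \<theta>
    by (auto simp: indicator_def)
  ultimately show ?thesis by (simp add: set_integrable_def)
qed

text \<open>Both ends carry a boundary term; it vanishes along suitable sequences of endpoints since
  \<open>1 / sin\<close> is not integrable at either end.\<close>

lemma integral_total_derivative_eq_0:
  fixes f g :: "real \<Rightarrow> complex" and W W' :: "real \<Rightarrow> real"
  assumes fg: "has_weak_deriv f g"
    and f2: "integrable interval_measure (\<lambda>\<theta>. (norm (f \<theta>))\<^sup>2 / sin \<theta>)"
    and J: "integrable interval_measure (\<lambda>\<theta>. 2 * W \<theta> * Re (cnj (f \<theta>) * g \<theta>) + W' \<theta> * (norm (f \<theta>))\<^sup>2)"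
    and W: "\<And>t. (W has_real_derivative W' t) (at t)" and W': "continuous_on UNIV W'"
    and B: "\<And>t. \<bar>W t\<bar> \<le> B"
  shows "(LINT \<theta>|interval_measure. 2 * W \<theta> * Re (cnj (f \<theta>) * g \<theta>) + W' \<theta> * (norm (f \<theta>))\<^sup>2) = 0"
proof -
  define Jf where "Jf \<theta> = 2 * W \<theta> * Re (cnj (f \<theta>) * g \<theta>) + W' \<theta> * (norm (f \<theta>))\<^sup>2" for \<theta>
  have lg: "locally_integrable g" using has_weak_derivD(2)[OF fg] .
  \<comment> \<open>Boundary terms need point values, which only the absolutely continuous
    representative has; \<open>f\<close> itself may be arbitrary on a null set.\<close>
  obtain F where F: "\<And>x y. 0 < x \<Longrightarrow> x \<le> y \<Longrightarrow> y < pi \<Longrightarrow> F y = F x + (LINT t:{x..y}|lebesgue. g t)"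
    and fF: "AE x in interval_measure. f x = F x"
    using weak_deriv_indefinite_integral[OF fg] by blast
  define JF where "JF \<theta> = 2 * W \<theta> * Re (cnj (F \<theta>) * g \<theta>) + W' \<theta> * (norm (F \<theta>))\<^sup>2" for \<theta>
  have lF: "locally_integrable F"
    unfolding locally_integrable_def
  proof (intro allI impI)
    fix a b :: real assume ab: "0 < a" "a \<le> b" "b < pi"
    have "continuous_on {a..b} F"
      by (rule indefinite_integral_continuous[OF locally_integrableD[OF lg, of a b] F]) (use ab in auto)
    then show "set_integrable lebesgue {a..b} F" by (rule absolutely_integrable_continuous_real)
  qed
  have mF [measurable]: "F \<in> borel_measurable interval_measure" by (rule locally_integrable_measurable[OF lF])
  have F2: "integrable interval_measure (\<lambda>\<theta>. (norm (F \<theta>))\<^sup>2 / sin \<theta>)"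
  proof (rule integrable_cong_AE_imp[OF f2])
    show "(\<lambda>\<theta>. (norm (F \<theta>))\<^sup>2 / sin \<theta>) \<in> borel_measurable interval_measure" by measurable
    show "AE x in interval_measure. (norm (f x))\<^sup>2 / sin x = (norm (F x))\<^sup>2 / sin x"
      using fF by eventually_elim simp
  qed
  then have F2': "set_integrable lebesgue {0<..<pi} (\<lambda>\<theta>. (norm (F \<theta>))\<^sup>2 / sin \<theta>)"
    by (simp add: set_integrable_def integrable_restrict_space)
  have small: "\<exists>x. 0 < x \<and> x < \<delta> \<and> h x < \<epsilon>"
    if h: "set_integrable lebesgue {0<..<pi} (\<lambda>\<theta>. h \<theta> / sin \<theta>)" and h0: "\<And>\<theta>. 0 \<le> h \<theta>"
      and "0 < \<delta>" "\<delta> \<le> pi" "0 < \<epsilon>"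
    for h :: "real \<Rightarrow> real" and \<delta> \<epsilon> :: real
  proof -
    have h': "set_integrable lebesgue {0<..<\<delta>} (\<lambda>\<theta>. h \<theta> / sin \<theta>)"
      by (rule set_integrable_subset[OF h]) (use \<open>\<delta> \<le> pi\<close> in auto)
    have "set_integrable lebesgue {0<..<\<delta>} (\<lambda>\<theta>. h \<theta> / \<theta>)"
    proof (rule set_integrable_bound[OF h'])
      \<comment> \<open>Measurability is at hand for \<open>h / sin\<close> only; multiplying by
        \<open>sin \<theta> / \<theta>\<close> yields it for the new quotient.\<close>
      have "(\<lambda>\<theta>::real. sin \<theta> / \<theta>) \<in> borel_measurable lebesgue"
        by (rule measurable_completion) simp
      then have "(\<lambda>\<theta>. (indicat_real {0<..<\<delta>} \<theta> *\<^sub>R (h \<theta> / sin \<theta>)) * (sin \<theta> / \<theta>)) \<in> borel_measurable lebesgue"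
        using h' by (intro borel_measurable_times) (auto simp: set_integrable_def intro: borel_measurable_integrable)
      moreover have "(indicat_real {0<..<\<delta>} \<theta> *\<^sub>R (h \<theta> / sin \<theta>)) * (sin \<theta> / \<theta>) = indicat_real {0<..<\<delta>} \<theta> *\<^sub>R (h \<theta> / \<theta>)" for \<theta>
        using \<open>\<delta> \<le> pi\<close> sin_gt_zero[of \<theta>] by (auto simp: indicator_def)
      ultimately show "set_borel_measurable lebesgue {0<..<\<delta>} (\<lambda>\<theta>. h \<theta> / \<theta>)"
        unfolding set_borel_measurable_def by (simp only:)
      show "AE x in lebesgue. x \<in> {0<..<\<delta>} \<longrightarrow> norm (h x / x) \<le> norm (h x / sin x)"
      proof (rule AE_I2, rule impI)
        fix x assume x: "x \<in> {0<..<\<delta>}"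
        then have "0 < sin x" "sin x \<le> x"
          using \<open>\<delta> \<le> pi\<close> by (auto intro: sin_gt_zero sin_x_le_x)
        then show "norm (h x / x) \<le> norm (h x / sin x)"
          using h0[of x] x by (auto intro: divide_left_mono)
      qed
    qed
    then show ?thesis using exists_small_near_0 \<open>0 < \<delta>\<close> \<open>0 < \<epsilon>\<close> by metis
  qed
  have le1: "1 / Suc n \<le> (1::real)" for n by simp
  have le_pi: "1 / Suc n \<le> pi" for n
    using le1[of n] pi_gt3 by linarith
  have "\<exists>x. 0 < x \<and> x < 1 / Suc n \<and> (norm (F x))\<^sup>2 < 1 / Suc n" for n
    by (rule small[OF F2']) (use le_pi in simp_all)
  then obtain x where x: "\<And>n. 0 < x n" "\<And>n. x n < 1 / Suc n" "\<And>n. (norm (F (x n)))\<^sup>2 < 1 / Suc n"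
    by metis
  have "\<exists>x. 0 < x \<and> x < 1 / Suc n \<and> (norm (F (pi - x)))\<^sup>2 < 1 / Suc n" for n
    by (rule small) (use integrable_reflect_interval[OF F2'] le_pi in simp_all)
  then obtain z where z: "\<And>n. 0 < z n" "\<And>n. z n < 1 / Suc n" "\<And>n. (norm (F (pi - z n)))\<^sup>2 < 1 / Suc n"
    by metis
  define y where "y n = pi - z n" for n
  \<comment> \<open>Both chosen points are less than \<open>1\<close> away from their ends, so they
    are in the right order as \<open>pi > 2\<close>.\<close>
  have xy: "0 < x n" "x n \<le> y n" "y n < pi" for n
  proof -
    have "x n < 1" "z n < 1"
      using x(2)[of n] z(2)[of n] le1[of n] by linarith+
    then show "0 < x n" "x n \<le> y n" "y n < pi"
      using x(1)[of n] z(1)[of n] pi_gt3 by (auto simp: y_def)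
  qed
  have lim0: "(\<lambda>n. 1 / Suc n) \<longlonglongrightarrow> (0::real)" by (rule LIMSEQ_Suc[OF lim_1_over_n])
  have lim_x: "x \<longlonglongrightarrow> 0"
    by (rule tendsto_sandwich[OF _ _ tendsto_const lim0]) (use x(1,2) in \<open>auto intro!: always_eventually less_imp_le\<close>)
  have "z \<longlonglongrightarrow> 0"
    by (rule tendsto_sandwich[OF _ _ tendsto_const lim0]) (use z(1,2) in \<open>auto intro!: always_eventually less_imp_le\<close>)
  then have lim_y: "y \<longlonglongrightarrow> pi"
    unfolding y_def using tendsto_diff[OF tendsto_const, of z 0 sequentially pi] by simp
  have AE_J: "AE \<theta> in interval_measure. Jf \<theta> = JF \<theta>"
    using fF by eventually_elim (simp add: Jf_def JF_def)
  have eq: "(LINT \<theta>|interval_measure. indicator {x n..y n} \<theta> * Jf \<theta>) =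
      (norm (F (y n)))\<^sup>2 * W (y n) - (norm (F (x n)))\<^sup>2 * W (x n)" for n
  proof -
    have mg: "g \<in> borel_measurable interval_measure"
      by (rule locally_integrable_measurable[OF lg])
    have mJ: "Jf \<in> borel_measurable interval_measure"
      using J unfolding Jf_def[abs_def] by (rule borel_measurable_integrable)
    have cW: "continuous_on {0<..<pi} W"
      by (rule DERIV_continuous_on[where D=W']) (rule has_field_derivative_at_within[OF W])
    have mW: "W \<in> borel_measurable interval_measure" and mW': "W' \<in> borel_measurable interval_measure"
      using cW continuous_on_subset[OF W'] by (auto intro: continuous_imp_measurable_on_sets_lebesgue)
    have mJF: "JF \<in> borel_measurable interval_measure"
    proof -
      have "(\<lambda>\<theta>. cnj (F \<theta>)) \<in> borel_measurable interval_measure"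
        by (rule borel_measurable_continuous_on[OF _ mF]) (intro continuous_intros)
      then have "(\<lambda>\<theta>. Re (cnj (F \<theta>) * g \<theta>)) \<in> borel_measurable interval_measure"
        by (intro borel_measurable_continuous_on[of Re, OF _ borel_measurable_times[OF _ mg]] continuous_intros)
      then show ?thesis
        unfolding JF_def[abs_def]
        by (intro borel_measurable_add borel_measurable_times borel_measurable_power
            borel_measurable_const measurable_compose[OF mF borel_measurable_norm] mW mW')
    qed
    have ind: "indicat_real {x n..y n} \<in> borel_measurable interval_measure"
      by (rule measurable_restrict_space1) (rule borel_measurable_indicator, simp)
    have "(LINT \<theta>|interval_measure. indicator {x n..y n} \<theta> * Jf \<theta>) =
        (LINT \<theta>|interval_measure. indicator {x n..y n} \<theta> * JF \<theta>)"
    proof (rule integral_cong_AE)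
      show "AE \<theta> in interval_measure. indicat_real {x n..y n} \<theta> * Jf \<theta> = indicat_real {x n..y n} \<theta> * JF \<theta>"
        using AE_J by eventually_elim simp
    qed (intro borel_measurable_times ind mJ mJF)+
    also have "\<dots> = (LINT \<theta>:{x n..y n}|lebesgue. JF \<theta>)"
    proof -
      have "indicat_real {0<..<pi} \<theta> *\<^sub>R (indicat_real {x n..y n} \<theta> * JF \<theta>) = indicat_real {x n..y n} \<theta> *\<^sub>R JF \<theta>" for \<theta>
        using xy[of n] by (auto simp: indicator_def)
      moreover have "(LINT \<theta>|interval_measure. indicat_real {x n..y n} \<theta> * JF \<theta>) =
          (LINT \<theta>|lebesgue. indicat_real {0<..<pi} \<theta> *\<^sub>R (indicat_real {x n..y n} \<theta> * JF \<theta>))"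
        by (rule integral_restrict_space) simp
      ultimately show ?thesis unfolding set_lebesgue_integral_def by (simp only:)
    qed
    also have "\<dots> = (norm (F (y n)))\<^sup>2 * W (y n) - (norm (F (x n)))\<^sup>2 * W (x n)"
      unfolding JF_def
    proof (rule indefinite_integral_abs_square[OF _ _ _ W W'])
      show "set_integrable lebesgue {x n..y n} g" by (rule locally_integrableD[OF lg xy(1,3)])
      show "x n \<le> y n" by (rule xy)
      show "F t = F (x n) + (LINT s:{x n..t}|lebesgue. g s)" if "t \<in> {x n..y n}" for t
        by (rule F) (use xy[of n] that in auto)
    qed
    finally show ?thesis .
  qed
  have "(\<lambda>n. (norm (F (y n)))\<^sup>2 * W (y n) - (norm (F (x n)))\<^sup>2 * W (x n)) \<longlonglongrightarrow> 0"
  proof (rule Lim_null_comparison)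
    show "\<forall>\<^sub>F n in sequentially. norm ((norm (F (y n)))\<^sup>2 * W (y n) - (norm (F (x n)))\<^sup>2 * W (x n)) \<le> 1 / Suc n * B + 1 / Suc n * B"
    proof (rule always_eventually, rule allI)
      fix n
      have "norm ((norm (F (y n)))\<^sup>2 * W (y n) - (norm (F (x n)))\<^sup>2 * W (x n)) \<le>
        \<bar>(norm (F (y n)))\<^sup>2 * W (y n)\<bar> + \<bar>(norm (F (x n)))\<^sup>2 * W (x n)\<bar>"
        unfolding real_norm_def by (rule abs_triangle_ineq4)
      also have "\<dots> = (norm (F (y n)))\<^sup>2 * \<bar>W (y n)\<bar> + (norm (F (x n)))\<^sup>2 * \<bar>W (x n)\<bar>"
        by (simp add: abs_mult)
      also have "\<dots> \<le> 1 / Suc n * B + 1 / Suc n * B"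
        using x(3)[of n] z(3)[of n] B[of "x n"] B[of "y n"]
        by (intro add_mono mult_mono) (auto simp: y_def intro: less_imp_le)
      finally show "norm ((norm (F (y n)))\<^sup>2 * W (y n) - (norm (F (x n)))\<^sup>2 * W (x n)) \<le> 1 / Suc n * B + 1 / Suc n * B" .
    qed
    show "(\<lambda>n. 1 / Suc n * B + 1 / Suc n * B) \<longlonglongrightarrow> 0"
      using tendsto_add[OF tendsto_mult_right[OF lim0, of B] tendsto_mult_right[OF lim0, of B]] by simp
  qed
  moreover have "(\<lambda>n. LINT \<theta>|interval_measure. indicator {x n..y n} \<theta> * Jf \<theta>) \<longlonglongrightarrow> (LINT \<theta>|interval_measure. Jf \<theta>)"
  proof (rule integral_dominated_convergence[where w="\<lambda>\<theta>. norm (Jf \<theta>)"])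
    have iJ: "integrable interval_measure Jf" using J unfolding Jf_def[abs_def] .
    then show mJ: "Jf \<in> borel_measurable interval_measure" by (rule borel_measurable_integrable)
    show "integrable interval_measure (\<lambda>\<theta>. norm (Jf \<theta>))" using iJ by (rule integrable_norm)
    show "(\<lambda>\<theta>. indicat_real {x n..y n} \<theta> * Jf \<theta>) \<in> borel_measurable interval_measure" for n
      by (intro borel_measurable_times mJ measurable_restrict_space1 borel_measurable_indicator) simp
    show "AE \<theta> in interval_measure. norm (indicat_real {x n..y n} \<theta> * Jf \<theta>) \<le> norm (Jf \<theta>)" for n
      by (rule AE_I2) (simp add: indicator_def)
    show "AE \<theta> in interval_measure. (\<lambda>n. indicat_real {x n..y n} \<theta> * Jf \<theta>) \<longlonglongrightarrow> Jf \<theta>"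
    proof (rule AE_interval)
      fix \<theta> :: real assume "0 < \<theta>" "\<theta> < pi"
      then have "\<forall>\<^sub>F n in sequentially. x n < \<theta>" "\<forall>\<^sub>F n in sequentially. \<theta> < y n"
        using order_tendstoD(2)[OF lim_x] order_tendstoD(1)[OF lim_y] by auto
      then have "\<forall>\<^sub>F n in sequentially. indicat_real {x n..y n} \<theta> * Jf \<theta> = Jf \<theta>"
        by eventually_elim (simp add: indicator_def)
      then show "(\<lambda>n. indicat_real {x n..y n} \<theta> * Jf \<theta>) \<longlonglongrightarrow> Jf \<theta>"
        by (rule tendsto_eventually)
    qed
  qed
  ultimately have "(LINT \<theta>|interval_measure. Jf \<theta>) = 0"
    unfolding eq using LIMSEQ_unique by blast
  then show ?thesis by (simp add: Jf_def)
qed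

section \<open>Bounds for the quadratic forms\<close>

lemma q_domD:
  assumes "f \<in> q_dom m"
  shows "f \<in> H_space" "has_weak_deriv f (weak_deriv f)" "weak_deriv f \<in> H_space"
    and "m \<noteq> 0 \<Longrightarrow> integrable interval_measure (\<lambda>\<theta>. (norm (f \<theta>))\<^sup>2 / sin \<theta>)"
proof -
  show "f \<in> H_space" "weak_deriv f \<in> H_space" using assms by (auto simp: q_dom_def split: if_splits)
  have "weakly_differentiable f" using assms by (auto simp: q_dom_def split: if_splits)
  then show "has_weak_deriv f (weak_deriv f)"
    unfolding weakly_differentiable_def weak_deriv_def by (rule someI_ex)
  assume "m \<noteq> 0"
  then have i: "integrable interval_measure (\<lambda>\<theta>. sin \<theta> * (norm (of_real (1 / sin \<theta>) * f \<theta>))\<^sup>2)"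
    using assms by (simp add: q_dom_def H_space_iff)
  have eq: "sin \<theta> * (norm (of_real (1 / sin \<theta>) * f \<theta>))\<^sup>2 = (norm (f \<theta>))\<^sup>2 / sin \<theta>"
    if "\<theta> \<in> space interval_measure" for \<theta>
    using that by (simp add: norm_mult norm_divide power2_eq_square)
  show "integrable interval_measure (\<lambda>\<theta>. (norm (f \<theta>))\<^sup>2 / sin \<theta>)"
    using i Bochner_Integration.integrable_cong[OF refl eq] by (rule iffD1[rotated])
qed

text \<open>Multiplied by \<open>sin\<close>, the mixed term of the squared potential is
  \<open>- m * b * |f|^2\<close>, with no weight left. It is controlled by the singular term since
  \<open>sin \<le> 1\<close>.\<close>

lemma integrable_norm_square:
  fixes f :: "real \<Rightarrow> complex"
  assumes "integrable interval_measure (\<lambda>\<theta>. (norm (f \<theta>))\<^sup>2 / sin \<theta>)"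
    and [measurable]: "f \<in> borel_measurable interval_measure"
  shows "integrable interval_measure (\<lambda>\<theta>. (norm (f \<theta>))\<^sup>2)"
proof (rule Bochner_Integration.integrable_bound[OF assms(1)])
  show "(\<lambda>\<theta>. (norm (f \<theta>))\<^sup>2) \<in> borel_measurable interval_measure" by measurable
  show "AE \<theta> in interval_measure. norm ((norm (f \<theta>))\<^sup>2) \<le> norm ((norm (f \<theta>))\<^sup>2 / sin \<theta>)"
  proof (rule AE_interval)
    fix \<theta> :: real assume "0 < \<theta>" "\<theta> < pi"
    then have s: "0 < sin \<theta>" by (rule sin_gt_zero)
    have "(norm (f \<theta>))\<^sup>2 / 1 \<le> (norm (f \<theta>))\<^sup>2 / sin \<theta>"
      by (rule divide_left_mono) (use s in auto)
    then show "norm ((norm (f \<theta>))\<^sup>2) \<le> norm ((norm (f \<theta>))\<^sup>2 / sin \<theta>)" using s by simp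
  qed
qed

text \<open>The integral of a non-integrable function is \<open>0\<close> by convention, which would
  ruin any lower bound; membership in the form domain excludes this.\<close>

lemma integrable_q_form:
  assumes f: "f \<in> q_dom m"
  shows "integrable interval_measure
     (\<lambda>\<theta>. sin \<theta> * ((norm (weak_deriv f \<theta>))\<^sup>2 + (of_int m / sin \<theta> - b / 2)\<^sup>2 * (norm (f \<theta>))\<^sup>2))"
proof -
  note D = q_domD[OF f]
  have N: "integrable interval_measure (\<lambda>\<theta>. sin \<theta> * (norm (f \<theta>))\<^sup>2)"
    and G: "integrable interval_measure (\<lambda>\<theta>. sin \<theta> * (norm (weak_deriv f \<theta>))\<^sup>2)"
    and mf: "f \<in> borel_measurable interval_measure"
    using D by (auto simp: H_space_iff)
  show ?thesis
  \<comment> \<open>For \<open>m = 0\<close> the domain says nothing about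
    \<open>|f|^2 / sin\<close>, but then the potential is constant.\<close>
  proof (cases "m = 0")
    case True
    have "sin \<theta> * ((norm (weak_deriv f \<theta>))\<^sup>2 + (of_int m / sin \<theta> - b / 2)\<^sup>2 * (norm (f \<theta>))\<^sup>2) =
        sin \<theta> * (norm (weak_deriv f \<theta>))\<^sup>2 + (b / 2)\<^sup>2 * (sin \<theta> * (norm (f \<theta>))\<^sup>2)" for \<theta>
      using True by (simp add: algebra_simps)
    then show ?thesis
      using Bochner_Integration.integrable_add[OF G integrable_mult_right[OF N, of "(b / 2)\<^sup>2"]] by (simp only:)
  next
    case False
    note Z = D(4)[OF False]
    note F2 = integrable_norm_square[OF Z mf]
    have "integrable interval_measure (\<lambda>\<theta>. sin \<theta> * (norm (weak_deriv f \<theta>))\<^sup>2 +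
        ((of_int m)\<^sup>2 * ((norm (f \<theta>))\<^sup>2 / sin \<theta>) - of_int m * b * (norm (f \<theta>))\<^sup>2 + (b / 2)\<^sup>2 * (sin \<theta> * (norm (f \<theta>))\<^sup>2)))"
      (is "integrable _ ?h") by (intro Bochner_Integration.integrable_add Bochner_Integration.integrable_diff integrable_mult_right G Z F2 N)
    moreover have "?h \<theta> = sin \<theta> * ((norm (weak_deriv f \<theta>))\<^sup>2 + (of_int m / sin \<theta> - b / 2)\<^sup>2 * (norm (f \<theta>))\<^sup>2)"
      if "\<theta> \<in> space interval_measure" for \<theta>
    proof -
      have "sin \<theta> \<noteq> 0" using that sin_gt_zero[of \<theta>] by auto
      then show ?thesis by (simp add: field_simps power2_eq_square)
    qed
    ultimately show ?thesis
      by (rule iffD1[OF Bochner_Integration.integrable_cong[OF refl], rotated])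
  qed
qed

lemma q_form_eq:
  assumes f: "f \<in> q_dom m"
  shows "q_form m b f = (LINT \<theta>|interval_measure.
      sin \<theta> * ((norm (weak_deriv f \<theta>))\<^sup>2 + (of_int m / sin \<theta> - b / 2)\<^sup>2 * (norm (f \<theta>))\<^sup>2))"
  unfolding q_form_def
proof (rule integral_sphere_measure)
  have [measurable]: "f \<in> borel_measurable interval_measure" "weak_deriv f \<in> borel_measurable interval_measure"
    using q_domD[OF f] by (auto simp: H_space_iff)
  show "(\<lambda>\<theta>. (norm (weak_deriv f \<theta>))\<^sup>2 + (of_int m / sin \<theta> - b / 2)\<^sup>2 * (norm (f \<theta>))\<^sup>2)
      \<in> borel_measurable interval_measure"
    by measurable
qed

lemma q_form_nonneg: "0 \<le> q_form m b f"
  unfolding q_form_def by (rule Bochner_Integration.integral_nonneg) auto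

lemma q_form_ge_potential:
  assumes f: "f \<in> q_dom m" and c: "\<And>\<theta>. 0 < \<theta> \<Longrightarrow> \<theta> < pi \<Longrightarrow> c \<le> (of_int m / sin \<theta> - b / 2)\<^sup>2"
  shows "c * (H_norm f)\<^sup>2 \<le> q_form m b f"
proof -
  note D = q_domD[OF f]
  have N: "integrable interval_measure (\<lambda>\<theta>. sin \<theta> * (norm (f \<theta>))\<^sup>2)"
    using D by (auto simp: H_space_iff)
  have "c * (H_norm f)\<^sup>2 = (LINT \<theta>|interval_measure. c * (sin \<theta> * (norm (f \<theta>))\<^sup>2))"
    by (simp add: H_norm_square[OF D(1)])
  also have "\<dots> \<le> (LINT \<theta>|interval_measure.
      sin \<theta> * ((norm (weak_deriv f \<theta>))\<^sup>2 + (of_int m / sin \<theta> - b / 2)\<^sup>2 * (norm (f \<theta>))\<^sup>2))"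
  proof (rule integral_mono)
    fix \<theta> assume "\<theta> \<in> space interval_measure"
    then have \<theta>: "0 < \<theta>" "\<theta> < pi" by auto
    have "c * (norm (f \<theta>))\<^sup>2 \<le> (norm (weak_deriv f \<theta>))\<^sup>2 + (of_int m / sin \<theta> - b / 2)\<^sup>2 * (norm (f \<theta>))\<^sup>2"
      using mult_right_mono[OF c[OF \<theta>], of "(norm (f \<theta>))\<^sup>2"] by (simp add: add_increasing)
    then have "sin \<theta> * (c * (norm (f \<theta>))\<^sup>2) \<le>
        sin \<theta> * ((norm (weak_deriv f \<theta>))\<^sup>2 + (of_int m / sin \<theta> - b / 2)\<^sup>2 * (norm (f \<theta>))\<^sup>2)"
      by (rule mult_left_mono) (use sin_gt_zero[OF \<theta>] in simp)
    then show "c * (sin \<theta> * (norm (f \<theta>))\<^sup>2) \<le>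
        sin \<theta> * ((norm (weak_deriv f \<theta>))\<^sup>2 + (of_int m / sin \<theta> - b / 2)\<^sup>2 * (norm (f \<theta>))\<^sup>2)"
      by (simp only: mult.left_commute)
  qed (intro integrable_mult_right N integrable_q_form f)+
  finally show ?thesis by (simp add: q_form_eq[OF f])
qed

section \<open>The lower bound at \<open>b = 8/5\<close>\<close>

text \<open>With \<open>s = sin \<theta>\<close> and \<open>c = cos \<theta>\<close>, the right-hand
  side is the coefficient of \<open>|f|^2\<close> that remains after completing the square with the
  weight \<open>W = T * c\<close> and splitting off an exact derivative; the last bracket is
  \<open>W'\<close>. The quadratic term of \<open>T\<close> is needed near the equator: at
  \<open>s = 1\<close> the two sides differ by \<open>T - 3/5\<close>, which is \<open>1/15\<close>
  but would be \<open>-2/15\<close> without \<open>s^2 / 5\<close>.\<close>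

lemma riccati_inequality:
  fixes s c :: real
  assumes s: "0 < s" "s \<le> 1" and sc: "c\<^sup>2 = 1 - s\<^sup>2"
  defines "T \<equiv> 1 - 8/15 * s + s\<^sup>2 / 5"
  shows "16/25 * s \<le> s * (1 / s - 4/5)\<^sup>2 - (T * c)\<^sup>2 / s - ((- 8/15 + 2/5 * s) * c\<^sup>2 - T * s)"
proof -
  let ?p = "206/225 - 48/25 * s + 280/225 * s\<^sup>2 - 48/225 * s^3 + s^4 / 25"
  have "s * (1 / s - 4/5)\<^sup>2 - (T * c)\<^sup>2 / s - ((- 8/15 + 2/5 * s) * c\<^sup>2 - T * s) - 16/25 * s = s * ?p"
    unfolding power_mult_distrib sc T_def using s
    by (simp add: field_simps power2_eq_square power3_eq_cube power4_eq_xxxx)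
  moreover have "0 \<le> ?p"
  proof -
    \<comment> \<open>Replacing \<open>s^3\<close> by \<open>s^2\<close> and dropping
      \<open>s^4\<close> bounds \<open>225 * ?p\<close> below by
      \<open>206 - 432 * s + 232 * s^2\<close>. Its discriminant is negative; the displayed square
      divided by \<open>232\<close> has the same leading terms and a constant of about
      201.1.\<close>
    have "s^3 \<le> s\<^sup>2" using s by (intro power_decreasing) auto
    moreover have "0 \<le> (232 * s - 216)\<^sup>2" by simp
    then have "0 \<le> 206 - 432 * s + 232 * s\<^sup>2" by (simp add: power2_eq_square algebra_simps)
    moreover have "0 \<le> s^4" by simp
    ultimately show ?thesis by linarith
  qed
  then have "0 \<le> s * ?p" using s by simp
  ultimately show ?thesis by linarith
qed

text \<open>Completing the square with the logarithmic derivative of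
  \<open>sin \<theta> * exp (- 8/15 * sin \<theta> + sin \<theta>\<^sup>2 / 10)\<close>, an approximate ground state; the coefficient
  \<open>8/15 = b/3\<close> removes the \<open>1 / sin\<close> term of the resulting potential.\<close>

lemma q_form_ge_at_crossing:
  assumes f: "f \<in> q_dom 1"
  shows "16/25 * (H_norm f)\<^sup>2 \<le> q_form 1 (8/5) f"
proof -
  define T where "T \<theta> = 1 - 8/15 * sin \<theta> + (sin \<theta>)\<^sup>2 / 5" for \<theta> :: real
  \<comment> \<open>\<open>W / sin\<close> is the logarithmic derivative of the approximate ground
    state. The weight \<open>sin\<close> cancels its poles, so \<open>W\<close> is smooth and
    bounded on the whole line.\<close>
  define W where "W \<theta> = T \<theta> * cos \<theta>" for \<theta>
  define W' where "W' \<theta> = (- 8/15 + 2/5 * sin \<theta>) * (cos \<theta>)\<^sup>2 - T \<theta> * sin \<theta>" for \<theta>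
  define g where "g = weak_deriv f"
  define J where "J \<theta> = 2 * W \<theta> * Re (cnj (f \<theta>) * g \<theta>) + W' \<theta> * (norm (f \<theta>))\<^sup>2" for \<theta>
  note D = q_domD[OF f, folded g_def]
  have N: "integrable interval_measure (\<lambda>\<theta>. sin \<theta> * (norm (f \<theta>))\<^sup>2)"
    and G: "integrable interval_measure (\<lambda>\<theta>. sin \<theta> * (norm (g \<theta>))\<^sup>2)"
    and mf [measurable]: "f \<in> borel_measurable interval_measure"
    and mg [measurable]: "g \<in> borel_measurable interval_measure"
    using D by (auto simp: H_space_iff)
  have Z: "integrable interval_measure (\<lambda>\<theta>. (norm (f \<theta>))\<^sup>2 / sin \<theta>)" by (rule D(4)) simp
  note F2 = integrable_norm_square[OF Z mf]
  have dW: "(W has_real_derivative W' \<theta>) (at \<theta>)" for \<theta>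
    unfolding W_def[abs_def] W'_def T_def
    by (auto intro!: derivative_eq_intros simp: power2_eq_square field_simps)
  have cW': "continuous_on UNIV W'" and cW: "continuous_on UNIV W"
    unfolding W_def W'_def T_def by (auto intro!: continuous_intros)
  have T: "\<bar>T \<theta>\<bar> \<le> 2" for \<theta>
  proof -
    have "\<bar>sin \<theta>\<bar> \<le> 1" "0 \<le> (sin \<theta>)\<^sup>2" "(sin \<theta>)\<^sup>2 \<le> 1" by (auto simp: abs_square_le_1)
    then show ?thesis unfolding T_def by linarith
  qed
  have BW: "\<bar>W \<theta>\<bar> \<le> 2" for \<theta>
    unfolding W_def abs_mult using mult_mono[OF T, of "\<bar>cos \<theta>\<bar>" 1 \<theta>] by simp
  have BW': "\<bar>W' \<theta>\<bar> \<le> 4" for \<theta>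
  proof -
    have "\<bar>(- 8/15 + 2/5 * sin \<theta>) * (cos \<theta>)\<^sup>2\<bar> \<le> 1 * 1"
      unfolding abs_mult
    proof (intro mult_mono)
      show "\<bar>- 8/15 + 2/5 * sin \<theta>\<bar> \<le> 1"
        unfolding abs_le_iff using sin_le_one[of \<theta>] sin_ge_minus_one[of \<theta>] by linarith
    qed (auto simp: abs_square_le_1)
    moreover have "\<bar>T \<theta> * sin \<theta>\<bar> \<le> 2 * 1"
      unfolding abs_mult by (intro mult_mono T) auto
    ultimately show ?thesis unfolding W'_def by linarith
  qed
  \<comment> \<open>This majorant of \<open>J\<close> comes from
    \<open>2 * |f| * |g| \<le> sin * |g|^2 + |f|^2 / sin\<close> together with the bounds
    \<open>2\<close> for \<open>W\<close> and \<open>4\<close> for \<open>W'\<close>.\<close>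
  have "integrable interval_measure (\<lambda>\<theta>. 2 * (sin \<theta> * (norm (g \<theta>))\<^sup>2 + (norm (f \<theta>))\<^sup>2 / sin \<theta>) + 4 * (norm (f \<theta>))\<^sup>2)"
    by (intro Bochner_Integration.integrable_add integrable_mult_right G Z F2)
  then have iJ: "integrable interval_measure J"
  proof (rule Bochner_Integration.integrable_bound)
    have mW: "W \<in> borel_measurable interval_measure" and mW': "W' \<in> borel_measurable interval_measure"
      using continuous_on_subset[OF cW] continuous_on_subset[OF cW']
      by (auto intro: continuous_imp_measurable_on_sets_lebesgue)
    have "(\<lambda>\<theta>. cnj (f \<theta>)) \<in> borel_measurable interval_measure"
      by (rule borel_measurable_continuous_on[OF _ mf]) (intro continuous_intros)
    then have "(\<lambda>\<theta>. Re (cnj (f \<theta>) * g \<theta>)) \<in> borel_measurable interval_measure"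
      by (intro borel_measurable_continuous_on[of Re, OF _ borel_measurable_times[OF _ mg]] continuous_intros)
    then show "J \<in> borel_measurable interval_measure"
      unfolding J_def[abs_def]
      by (intro borel_measurable_add borel_measurable_times borel_measurable_power
          borel_measurable_const measurable_compose[OF mf borel_measurable_norm] mW mW')
    show "AE \<theta> in interval_measure. norm (J \<theta>) \<le> norm (2 * (sin \<theta> * (norm (g \<theta>))\<^sup>2 + (norm (f \<theta>))\<^sup>2 / sin \<theta>) + 4 * (norm (f \<theta>))\<^sup>2)"
    proof (rule AE_interval)
      fix \<theta> :: real assume "0 < \<theta>" "\<theta> < pi"
      then have s: "0 < sin \<theta>" by (rule sin_gt_zero)
      have "0 \<le> (sin \<theta> * norm (g \<theta>) - norm (f \<theta>))\<^sup>2 / sin \<theta>" using s by simp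
      also have "\<dots> = sin \<theta> * (norm (g \<theta>))\<^sup>2 + (norm (f \<theta>))\<^sup>2 / sin \<theta> - 2 * (norm (f \<theta>) * norm (g \<theta>))"
        using s by (simp add: field_simps power2_eq_square)
      finally have 1: "2 * (norm (f \<theta>) * norm (g \<theta>)) \<le> sin \<theta> * (norm (g \<theta>))\<^sup>2 + (norm (f \<theta>))\<^sup>2 / sin \<theta>" by simp
      have "\<bar>Re (cnj (f \<theta>) * g \<theta>)\<bar> \<le> norm (f \<theta>) * norm (g \<theta>)"
        using abs_Re_le_cmod[of "cnj (f \<theta>) * g \<theta>"] by (simp only: norm_mult complex_mod_cnj)
      then have "\<bar>2 * W \<theta> * Re (cnj (f \<theta>) * g \<theta>)\<bar> \<le> (2 * 2) * (norm (f \<theta>) * norm (g \<theta>))"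
        unfolding abs_mult by (intro mult_mono) (use BW[of \<theta>] in auto)
      moreover have "\<bar>W' \<theta> * (norm (f \<theta>))\<^sup>2\<bar> \<le> 4 * (norm (f \<theta>))\<^sup>2"
        unfolding abs_mult by (intro mult_mono) (use BW'[of \<theta>] in auto)
      moreover have "x + y \<le> 2 * S + 4 * n" if "x \<le> 2 * 2 * k" "y \<le> 4 * n" "2 * k \<le> S" for x y S n k :: real
        using that by linarith
      ultimately have "\<bar>J \<theta>\<bar> \<le> 2 * (sin \<theta> * (norm (g \<theta>))\<^sup>2 + (norm (f \<theta>))\<^sup>2 / sin \<theta>) + 4 * (norm (f \<theta>))\<^sup>2"
        unfolding J_def using 1 by (intro order_trans[OF abs_triangle_ineq]) blast
      then show "norm (J \<theta>) \<le> norm (2 * (sin \<theta> * (norm (g \<theta>))\<^sup>2 + (norm (f \<theta>))\<^sup>2 / sin \<theta>) + 4 * (norm (f \<theta>))\<^sup>2)"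
        unfolding real_norm_def by linarith
    qed
  qed
  have "(LINT \<theta>|interval_measure. J \<theta>) = 0"
    unfolding J_def
    by (rule integral_total_derivative_eq_0[where W=W and W'=W', OF D(2) Z _ dW cW' BW]) (use iJ in \<open>simp add: J_def[abs_def]\<close>)
  \<comment> \<open>As \<open>J\<close> integrates to zero it may be added on the left, after which
    the integrands compare pointwise.\<close>
  then have "16/25 * (H_norm f)\<^sup>2 = (LINT \<theta>|interval_measure. J \<theta> + 16/25 * (sin \<theta> * (norm (f \<theta>))\<^sup>2))"
    using iJ N by (simp add: H_norm_square[OF D(1)])
  also have "\<dots> \<le> (LINT \<theta>|interval_measure.
      sin \<theta> * ((norm (g \<theta>))\<^sup>2 + (of_int 1 / sin \<theta> - 8/5 / 2)\<^sup>2 * (norm (f \<theta>))\<^sup>2))"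
  proof (rule integral_mono)
    show "integrable interval_measure (\<lambda>\<theta>. J \<theta> + 16/25 * (sin \<theta> * (norm (f \<theta>))\<^sup>2))"
      by (intro Bochner_Integration.integrable_add integrable_mult_right iJ N)
    show "integrable interval_measure (\<lambda>\<theta>. sin \<theta> * ((norm (g \<theta>))\<^sup>2 + (of_int 1 / sin \<theta> - 8/5 / 2)\<^sup>2 * (norm (f \<theta>))\<^sup>2))"
      unfolding g_def by (rule integrable_q_form[OF f])
    fix \<theta> assume "\<theta> \<in> space interval_measure"
    then have s: "0 < sin \<theta>" by (simp add: sin_gt_zero)
    \<comment> \<open>The completed square \<open>sin * |g - (W / sin) * f|^2\<close> with the inner
      denominator cleared.\<close>
    have "0 \<le> (norm (of_real (sin \<theta>) * g \<theta> - of_real (W \<theta>) * f \<theta>))\<^sup>2 / sin \<theta>"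
      using s by simp
    also have "(norm (of_real (sin \<theta>) * g \<theta> - of_real (W \<theta>) * f \<theta>))\<^sup>2 =
        (sin \<theta>)\<^sup>2 * (norm (g \<theta>))\<^sup>2 - sin \<theta> * (2 * W \<theta> * Re (cnj (f \<theta>) * g \<theta>)) + (W \<theta>)\<^sup>2 * (norm (f \<theta>))\<^sup>2"
      unfolding cmod_power2 by (simp add: power2_eq_square algebra_simps)
    also have "\<dots> / sin \<theta> = sin \<theta> * (norm (g \<theta>))\<^sup>2 - 2 * W \<theta> * Re (cnj (f \<theta>) * g \<theta>) + (W \<theta>)\<^sup>2 / sin \<theta> * (norm (f \<theta>))\<^sup>2"
      using s by (simp add: field_simps power2_eq_square)
    finally have 1: "2 * W \<theta> * Re (cnj (f \<theta>) * g \<theta>) \<le> sin \<theta> * (norm (g \<theta>))\<^sup>2 + (W \<theta>)\<^sup>2 / sin \<theta> * (norm (f \<theta>))\<^sup>2"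
      by linarith
    have "16/25 * sin \<theta> \<le> sin \<theta> * (1 / sin \<theta> - 4/5)\<^sup>2 - (W \<theta>)\<^sup>2 / sin \<theta> - W' \<theta>"
      unfolding W_def W'_def T_def by (rule riccati_inequality) (use s in \<open>auto simp: cos_squared_eq\<close>)
    from mult_right_mono[OF this, of "(norm (f \<theta>))\<^sup>2"]
    have "16/25 * (sin \<theta> * (norm (f \<theta>))\<^sup>2) \<le> sin \<theta> * (1 / sin \<theta> - 4/5)\<^sup>2 * (norm (f \<theta>))\<^sup>2
        - (W \<theta>)\<^sup>2 / sin \<theta> * (norm (f \<theta>))\<^sup>2 - W' \<theta> * (norm (f \<theta>))\<^sup>2"
      by (simp only: left_diff_distrib mult.assoc zero_le_power2 simp_thms)
    moreover have "sin \<theta> * ((norm (g \<theta>))\<^sup>2 + (of_int 1 / sin \<theta> - 8/5 / 2)\<^sup>2 * (norm (f \<theta>))\<^sup>2)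
       = sin \<theta> * (norm (g \<theta>))\<^sup>2 + sin \<theta> * (1 / sin \<theta> - 4/5)\<^sup>2 * (norm (f \<theta>))\<^sup>2"
      by (simp add: distrib_left)
    ultimately show "J \<theta> + 16/25 * (sin \<theta> * (norm (f \<theta>))\<^sup>2) \<le>
        sin \<theta> * ((norm (g \<theta>))\<^sup>2 + (of_int 1 / sin \<theta> - 8/5 / 2)\<^sup>2 * (norm (f \<theta>))\<^sup>2)"
      unfolding J_def using 1 by linarith
  qed
  also have "\<dots> = q_form 1 (8/5) f"
    unfolding g_def by (rule q_form_eq[OF f, symmetric])
  finally show ?thesis .
qed

lemma q_form_ge_8_5:
  assumes f: "f \<in> q_dom m"
  shows "16/25 * (H_norm f)\<^sup>2 \<le> q_form m (8/5) f"
proof (cases "m = 1")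
  case True
  then show ?thesis using q_form_ge_at_crossing f by simp
next
  case False
  \<comment> \<open>\<open>m / sin\<close> is at most \<open>0\<close> for \<open>m \<le> 0\<close>
    and at least \<open>2\<close> for \<open>m \<ge> 2\<close>, so its distance from
    \<open>4/5\<close> is at least \<open>4/5\<close>. For \<open>m = 1\<close> the potential drops
    to \<open>1/25\<close> at the equator, which is why the gradient has to help there.\<close>
  show ?thesis
  proof (rule q_form_ge_potential[OF f])
    fix \<theta> :: real assume "0 < \<theta>" "\<theta> < pi"
    then have s: "0 < sin \<theta>" by (rule sin_gt_zero)
    consider "m \<le> 0" | "2 \<le> m" using False by linarith
    then have "4/5 \<le> \<bar>of_int m / sin \<theta> - 8/5 / 2\<bar>"
    proof cases
      case 1
      then have "of_int m / sin \<theta> \<le> 0" using s by (simp add: divide_nonpos_pos)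
      then have "4/5 \<le> - (of_int m / sin \<theta> - 8/5 / 2)" by linarith
      also have "\<dots> \<le> \<bar>of_int m / sin \<theta> - 8/5 / 2\<bar>" by (rule abs_ge_minus_self)
      finally show ?thesis .
    next
      case 2
      have "of_int m / 1 \<le> of_int m / sin \<theta>"
        by (rule divide_left_mono) (use 2 s in auto)
      moreover have "(2::real) \<le> of_int m" using 2 by simp
      ultimately have "4/5 \<le> of_int m / sin \<theta> - 8/5 / 2" by linarith
      also have "\<dots> \<le> \<bar>of_int m / sin \<theta> - 8/5 / 2\<bar>" by (rule abs_ge_self)
      finally show ?thesis .
    qed
    then have "(4/5)\<^sup>2 \<le> (of_int m / sin \<theta> - 8/5 / 2)\<^sup>2"
      by (intro abs_le_square_iff[THEN iffD1]) simp
    then show "16/25 \<le> (of_int m / sin \<theta> - 8/5 / 2)\<^sup>2" by (simp add: power2_eq_square)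
  qed
qed

section \<open>Trial functions and the values of their forms\<close>

lemma integral_interval_continuous:
  fixes h :: "real \<Rightarrow> real"
  assumes "\<And>\<theta>. (H has_real_derivative h \<theta>) (at \<theta>)" "continuous_on UNIV h"
  shows "(LINT \<theta>|interval_measure. h \<theta>) = H pi - H 0"
proof -
  have "set_integrable lebesgue {0..pi} h"
    by (rule absolutely_integrable_continuous_real) (rule continuous_on_subset[OF assms(2)], simp)
  then have i: "set_integrable lebesgue {0<..<pi} h"
    by (rule set_integrable_subset) auto
  have "(h has_integral H pi - H 0) {0..pi}"
    by (rule fundamental_theorem_of_calculus)
      (simp_all add: has_field_derivative_at_within[OF assms(1)] flip: has_real_derivative_iff_has_vector_derivative)
  then have "(h has_integral H pi - H 0) {0<..<pi}"
    by (simp add: has_integral_Icc_iff_Ioo)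
  moreover have "(LINT \<theta>|interval_measure. h \<theta>) = (LINT \<theta>:{0<..<pi}|lebesgue. h \<theta>)"
    by (simp add: integral_restrict_space set_lebesgue_integral_def)
  ultimately show "(LINT \<theta>|interval_measure. h \<theta>) = H pi - H 0"
    using set_lebesgue_integral_eq_integral(2)[OF i] by (simp add: integral_unique)
qed

lemma integrable_interval_continuous:
  fixes h :: "real \<Rightarrow> real"
  assumes "continuous_on UNIV h"
  shows "integrable interval_measure h"
proof -
  have "set_integrable lebesgue {0..pi} h"
    by (rule absolutely_integrable_continuous_real) (rule continuous_on_subset[OF assms], simp)
  then have "set_integrable lebesgue {0<..<pi} h"
    by (rule set_integrable_subset) auto
  then show ?thesis
    by (simp add: set_integrable_def integrable_restrict_space)
qed

lemma weak_deriv_C1: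
  assumes "\<And>x. (u has_real_derivative u' x) (at x)" "continuous_on UNIV u'"
  shows "weakly_differentiable (\<lambda>x. of_real (u x))"
    and "AE \<theta> in interval_measure. weak_deriv (\<lambda>x. of_real (u x)) \<theta> = of_real (u' \<theta>)"
    and "weak_deriv (\<lambda>x. of_real (u x)) \<in> borel_measurable interval_measure"
proof -
  have w: "has_weak_deriv (\<lambda>x. of_real (u x)) (\<lambda>x. of_real (u' x))"
    by (rule has_weak_deriv_C1[OF assms])
  then show "weakly_differentiable (\<lambda>x. of_real (u x))" by (auto simp: weakly_differentiable_def)
  have w': "has_weak_deriv (\<lambda>x. of_real (u x)) (weak_deriv (\<lambda>x. of_real (u x)))"
    unfolding weak_deriv_def by (rule someI[where P="has_weak_deriv _", OF w])
  show "AE \<theta> in interval_measure. weak_deriv (\<lambda>x. of_real (u x)) \<theta> = of_real (u' \<theta>)"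
    by (rule has_weak_deriv_unique[OF w' w])
  show "weak_deriv (\<lambda>x. of_real (u x)) \<in> borel_measurable interval_measure"
    by (rule locally_integrable_measurable[OF has_weak_derivD(2)[OF w']])
qed

lemma H_space_continuous:
  fixes u :: "real \<Rightarrow> real"
  assumes "continuous_on UNIV u"
  shows "(\<lambda>\<theta>. of_real (u \<theta>)) \<in> H_space"
proof -
  have "(\<lambda>\<theta>. complex_of_real (u \<theta>)) \<in> borel_measurable interval_measure"
    using continuous_on_subset[OF assms]
    by (auto intro!: continuous_imp_measurable_on_sets_lebesgue continuous_intros)
  moreover have "integrable interval_measure (\<lambda>\<theta>. sin \<theta> * (u \<theta>)\<^sup>2)"
    by (intro integrable_interval_continuous continuous_intros assms)
  ultimately show ?thesis by (simp add: H_space_iff)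
qed

lemma weak_deriv_C1_H_space:
  assumes "\<And>x. (u has_real_derivative u' x) (at x)" "continuous_on UNIV u'"
  shows "weak_deriv (\<lambda>x. of_real (u x)) \<in> H_space"
proof -
  note w = weak_deriv_C1[OF assms]
  have "integrable interval_measure (\<lambda>\<theta>. sin \<theta> * (norm (complex_of_real (u' \<theta>)))\<^sup>2)"
    using H_space_continuous[OF assms(2)] by (simp add: H_space_iff)
  then have "integrable interval_measure (\<lambda>\<theta>. sin \<theta> * (norm (weak_deriv (\<lambda>x. of_real (u x)) \<theta>))\<^sup>2)"
  proof (rule integrable_cong_AE_imp)
    show "(\<lambda>\<theta>. sin \<theta> * (norm (weak_deriv (\<lambda>x. of_real (u x)) \<theta>))\<^sup>2) \<in> borel_measurable interval_measure"
      using w(3) by measurable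
    show "AE \<theta> in interval_measure. sin \<theta> * (norm (complex_of_real (u' \<theta>)))\<^sup>2 =
        sin \<theta> * (norm (weak_deriv (\<lambda>x. of_real (u x)) \<theta>))\<^sup>2"
      using w(2) by eventually_elim simp
  qed
  then show ?thesis using w(3) by (simp add: H_space_iff)
qed

lemma q_form_C1:
  assumes u: "\<And>x. (u has_real_derivative u' x) (at x)" "continuous_on UNIV u'"
    and dom: "(\<lambda>x. of_real (u x)) \<in> q_dom m"
  shows "q_form m b (\<lambda>x. of_real (u x)) = (LINT \<theta>|interval_measure.
      sin \<theta> * ((u' \<theta>)\<^sup>2 + (of_int m / sin \<theta> - b / 2)\<^sup>2 * (u \<theta>)\<^sup>2))"
  unfolding q_form_eq[OF dom]
proof (rule integral_cong_AE)
  have mu [measurable]: "u' \<in> borel_measurable interval_measure" "u \<in> borel_measurable interval_measure"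
    using continuous_on_subset[OF u(2)] DERIV_continuous_on[OF has_field_derivative_at_within[OF u(1)], of "{0<..<pi}"]
    by (auto intro!: continuous_imp_measurable_on_sets_lebesgue)
  show "(\<lambda>\<theta>. sin \<theta> * ((u' \<theta>)\<^sup>2 + (of_int m / sin \<theta> - b / 2)\<^sup>2 * (u \<theta>)\<^sup>2)) \<in> borel_measurable interval_measure"
    by measurable
  show "(\<lambda>\<theta>. sin \<theta> * ((norm (weak_deriv (\<lambda>x. of_real (u x)) \<theta>))\<^sup>2 + (of_int m / sin \<theta> - b / 2)\<^sup>2 * (norm (complex_of_real (u \<theta>)))\<^sup>2)) \<in> borel_measurable interval_measure"
    by (rule borel_measurable_integrable[OF integrable_q_form[OF dom]])
  show "AE \<theta> in interval_measure. sin \<theta> * ((norm (weak_deriv (\<lambda>x. of_real (u x)) \<theta>))\<^sup>2 + (of_int m / sin \<theta> - b / 2)\<^sup>2 * (norm (complex_of_real (u \<theta>)))\<^sup>2)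
    = sin \<theta> * ((u' \<theta>)\<^sup>2 + (of_int m / sin \<theta> - b / 2)\<^sup>2 * (u \<theta>)\<^sup>2)"
    using weak_deriv_C1(2)[OF u] by eventually_elim simp
qed

lemma H_space_cong:
  assumes "\<And>\<theta>. \<theta> \<in> space interval_measure \<Longrightarrow> f \<theta> = g \<theta>"
  shows "f \<in> H_space \<longleftrightarrow> g \<in> H_space"
proof -
  have "f \<in> borel_measurable interval_measure \<longleftrightarrow> g \<in> borel_measurable interval_measure"
    by (rule measurable_cong[OF assms])
  moreover have "integrable interval_measure (\<lambda>\<theta>. sin \<theta> * (norm (f \<theta>))\<^sup>2) \<longleftrightarrow>
      integrable interval_measure (\<lambda>\<theta>. sin \<theta> * (norm (g \<theta>))\<^sup>2)"
    by (rule Bochner_Integration.integrable_cong[OF refl]) (simp only: assms)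
  ultimately show ?thesis unfolding H_space_iff by (simp only:)
qed

text \<open>Besides being the trial function for \<open>m = 1\<close>, \<open>sin\<close> belongs to
  every form domain and thereby shows that each infimum runs over a nonempty set.\<close>

lemma sin_in_q_dom: "(\<lambda>\<theta>. of_real (sin \<theta>)) \<in> q_dom m"
proof -
  have "(\<lambda>\<theta>. complex_of_real (sin \<theta>)) \<in> H_space"
    by (intro H_space_continuous continuous_intros)
  moreover have "(\<lambda>\<theta>. of_real (1 / sin \<theta>) * complex_of_real (sin \<theta>)) \<in> H_space"
  proof -
    have one: "(\<lambda>\<theta>. complex_of_real 1) \<in> H_space"
      by (intro H_space_continuous continuous_intros)
    have "of_real (1 / sin \<theta>) * complex_of_real (sin \<theta>) = complex_of_real 1"
      if "\<theta> \<in> space interval_measure" for \<theta>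
      using that sin_gt_zero[of \<theta>] by simp
    from H_space_cong[OF this] one show ?thesis by (rule iffD2)
  qed
  moreover have "weakly_differentiable (\<lambda>\<theta>. of_real (sin \<theta>))" "weak_deriv (\<lambda>\<theta>. of_real (sin \<theta>)) \<in> H_space"
    by (rule weak_deriv_C1(1)[where u=sin and u'=cos] weak_deriv_C1_H_space[where u=sin and u'=cos];
        auto intro!: derivative_eq_intros continuous_intros)+
  ultimately show ?thesis by (simp add: q_dom_def)
qed

lemma one_in_q_dom: "(\<lambda>\<theta>. of_real 1) \<in> q_dom 0"
proof -
  have "(\<lambda>\<theta>. complex_of_real 1) \<in> H_space"
    by (intro H_space_continuous continuous_intros)
  moreover have "weakly_differentiable (\<lambda>\<theta>::real. complex_of_real 1)" "weak_deriv (\<lambda>\<theta>::real. complex_of_real 1) \<in> H_space"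
    by (rule weak_deriv_C1(1)[where u="\<lambda>_. 1" and u'="\<lambda>_. 0"] weak_deriv_C1_H_space[where u="\<lambda>_. 1" and u'="\<lambda>_. 0"];
        auto intro!: derivative_eq_intros continuous_intros)+
  ultimately show ?thesis by (simp add: q_dom_def)
qed

lemma not_AE_zero:
  fixes u :: "real \<Rightarrow> real"
  assumes "\<And>\<theta>. 0 < \<theta> \<Longrightarrow> \<theta> < pi \<Longrightarrow> u \<theta> \<noteq> 0"
  shows "\<not> (AE \<theta> in sphere_measure. complex_of_real (u \<theta>) = 0)"
proof
  assume "AE \<theta> in sphere_measure. complex_of_real (u \<theta>) = 0"
  then have "AE \<theta> in interval_measure. complex_of_real (u \<theta>) = 0" by (simp add: AE_sphere_measure)
  then have "AE \<theta> in interval_measure. False"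
    using AE_space by eventually_elim (use assms in auto)
  then have "emeasure interval_measure (space interval_measure) = 0"
    by (simp add: eventually_False ae_filter_eq_bot_iff del: space_restrict_space space_lebesgue_on)
  then show False by (simp add: emeasure_restrict_space)
qed

section \<open>From the forms to their infima, and the three values of \<open>e_fun\<close>\<close>

lemma lambda_ev_ge:
  assumes "\<And>f. f \<in> q_dom m \<Longrightarrow> c * (H_norm f)\<^sup>2 \<le> q_form m b f"
  shows "c \<le> lambda_ev m b"
  unfolding lambda_ev_def
proof (rule cINF_greatest)
  have "\<not> (AE \<theta> in sphere_measure. complex_of_real (sin \<theta>) = 0)"
    by (rule not_AE_zero) (simp add: sin_gt_zero less_imp_neq[symmetric])
  then show "{f \<in> q_dom m. \<not> (AE \<theta> in sphere_measure. f \<theta> = 0)} \<noteq> {}"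
    using sin_in_q_dom[of m] by blast
  fix f assume f: "f \<in> {f \<in> q_dom m. \<not> (AE \<theta> in sphere_measure. f \<theta> = 0)}"
  then have "0 < (H_norm f)\<^sup>2" using H_norm_pos q_domD(1) by blast
  then show "c \<le> q_form m b f / (H_norm f)\<^sup>2"
    using assms[of f] f by (simp add: pos_le_divide_eq)
qed

lemma lambda_ev_nonneg: "0 \<le> lambda_ev m b"
  by (rule lambda_ev_ge) (simp add: q_form_nonneg)

lemma e_fun_le:
  assumes "f \<in> q_dom m" "\<not> (AE \<theta> in sphere_measure. f \<theta> = 0)"
  shows "e_fun b \<le> q_form m b f / (H_norm f)\<^sup>2"
proof -
  have "e_fun b \<le> lambda_ev m b"
    unfolding e_fun_def by (rule cINF_lower) (auto intro!: bdd_belowI[of _ 0] lambda_ev_nonneg)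
  also have "\<dots> \<le> q_form m b f / (H_norm f)\<^sup>2"
    unfolding lambda_ev_def
    by (rule cINF_lower) (use assms in \<open>auto intro!: bdd_belowI[of _ 0] divide_nonneg_nonneg q_form_nonneg\<close>)
  finally show ?thesis .
qed

lemma e_fun_8_5: "16/25 \<le> e_fun (8/5)"
  unfolding e_fun_def by (rule cINF_greatest, simp) (rule lambda_ev_ge, rule q_form_ge_8_5)

lemma e_fun_1: "e_fun 1 \<le> 1/4"
proof -
  let ?f = "\<lambda>\<theta>::real. complex_of_real 1"
  have sin: "(LINT \<theta>|interval_measure. sin \<theta>) = 2"
    by (subst integral_interval_continuous[where H="\<lambda>\<theta>. - cos \<theta>"])
      (auto intro!: derivative_eq_intros continuous_intros)
  have "q_form 0 1 ?f = (LINT \<theta>|interval_measure. sin \<theta> * ((0::real)\<^sup>2 + (of_int 0 / sin \<theta> - 1 / 2)\<^sup>2 * 1\<^sup>2))"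
    by (rule q_form_C1[where u="\<lambda>_. 1" and u'="\<lambda>_. 0"]) (auto intro!: derivative_eq_intros continuous_intros one_in_q_dom[simplified])
  also have "\<dots> = (LINT \<theta>|interval_measure. sin \<theta> * (1/4))"
    by (simp add: power2_eq_square)
  also have "\<dots> = 1/2" using sin by simp
  finally have q: "q_form 0 1 ?f = 1/2" .
  have "(H_norm ?f)\<^sup>2 = 2"
    using H_norm_square[OF q_domD(1)[OF one_in_q_dom]] sin by simp
  then show ?thesis
    using e_fun_le[OF one_in_q_dom not_AE_zero, of 1] q by simp
qed

lemma e_fun_12_5: "e_fun (12/5) \<le> 86/25 - 9/10 * pi"
proof -
  let ?f = "\<lambda>\<theta>. complex_of_real (sin \<theta>)"
  \<comment> \<open>Rewriting with these removes even powers of \<open>cos\<close>; the second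
    equation catches them inside right-nested products.\<close>
  have pyth: "cos \<theta> * cos \<theta> = 1 - sin \<theta> * sin \<theta>"
    "cos \<theta> * (cos \<theta> * x) = x - sin \<theta> * (sin \<theta> * x)" for \<theta> x :: real
    using cos_squared_eq[of \<theta>] by (simp_all add: power2_eq_square left_diff_distrib flip: mult.assoc)
  have "(H_norm ?f)\<^sup>2 = (LINT \<theta>|interval_measure. (sin \<theta>)^3)"
    unfolding H_norm_square[OF q_domD(1)[OF sin_in_q_dom]] by (simp add: power2_eq_square power3_eq_cube mult.assoc)
  also have "\<dots> = 4/3"
    by (subst integral_interval_continuous[where H="\<lambda>\<theta>. - cos \<theta> + (cos \<theta>)^3 / 3"])
      (auto intro!: derivative_eq_intros continuous_intros
        simp: power2_eq_square power3_eq_cube pyth algebra_simps diff_divide_distrib)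
  finally have N: "(H_norm ?f)\<^sup>2 = 4/3" .
  have "q_form 1 (12/5) ?f = (LINT \<theta>|interval_measure. sin \<theta> * ((cos \<theta>)\<^sup>2 + (of_int 1 / sin \<theta> - 12/5 / 2)\<^sup>2 * (sin \<theta>)\<^sup>2))"
    by (rule q_form_C1[where u=sin and u'=cos]) (auto intro!: derivative_eq_intros continuous_intros sin_in_q_dom)
  also have "\<dots> = (LINT \<theta>|interval_measure. 2 * sin \<theta> - 12/5 * (sin \<theta>)\<^sup>2 + 11/25 * (sin \<theta>)^3)"
  proof (rule Bochner_Integration.integral_cong[OF refl])
    fix \<theta> assume "\<theta> \<in> space interval_measure"
    then have "sin \<theta> \<noteq> 0" using sin_gt_zero[of \<theta>] by auto
    then have eq: "(of_int 1 / sin \<theta> - 12/5 / 2)\<^sup>2 * (sin \<theta>)\<^sup>2 = (1 - 6/5 * sin \<theta>)\<^sup>2"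
      by (simp add: field_simps power2_eq_square)
    show "sin \<theta> * ((cos \<theta>)\<^sup>2 + (of_int 1 / sin \<theta> - 12/5 / 2)\<^sup>2 * (sin \<theta>)\<^sup>2) =
        2 * sin \<theta> - 12/5 * (sin \<theta>)\<^sup>2 + 11/25 * (sin \<theta>)^3"
      unfolding eq by (simp add: power2_eq_square power3_eq_cube pyth field_simps)
  qed
  \<comment> \<open>The integrals of \<open>sin\<close>, \<open>sin^2\<close> and
    \<open>sin^3\<close> are \<open>2\<close>, \<open>pi/2\<close> and \<open>4/3\<close>;
    \<open>H\<close> combines their primitives with the coefficients \<open>2\<close>,
    \<open>-12/5\<close> and \<open>11/25\<close>.\<close>
  also have "\<dots> = 344/75 - 6/5 * pi"
    by (subst integral_interval_continuous[where
          H="\<lambda>\<theta>. - 2 * cos \<theta> - 6/5 * (\<theta> - sin \<theta> * cos \<theta>) + 11/25 * (- cos \<theta> + (cos \<theta>)^3 / 3)"])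
      (auto intro!: derivative_eq_intros continuous_intros
        simp: power2_eq_square power3_eq_cube pyth algebra_simps diff_divide_distrib)
  finally have q: "q_form 1 (12/5) ?f = 344/75 - 6/5 * pi" .
  have "e_fun (12/5) \<le> (344/75 - 6/5 * pi) / (4/3)"
    using e_fun_le[OF sin_in_q_dom not_AE_zero, of "12/5" 1] q N by (simp add: sin_gt_zero less_imp_neq[symmetric])
  then show ?thesis by simp
qed

theorem theorem1:
  shows "\<not> mono_on {0<..} e_fun \<and> \<not> antimono_on {0<..} e_fun"
proof (intro conjI notI)
  assume "mono_on {0<..} e_fun"
  then have "e_fun (8/5) \<le> e_fun (12/5)" by (rule mono_onD) auto
  \<comment> \<open>\<open>86/25 - 9/10 * pi < 16/25\<close> amounts to \<open>pi > 28/9\<close>,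
    for which \<open>pi > 3\<close> would be too weak.\<close>
  then show False using e_fun_8_5 e_fun_12_5 pi_approx(1) by simp
next
  assume "antimono_on {0<..} e_fun"
  then have "e_fun (8/5) \<le> e_fun 1" by (rule monotone_onD) auto
  then show False using e_fun_8_5 e_fun_1 by simp
qed

end
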